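(* Let $c_1>c_2>0$, let $Y^{\mathrm{an}}$ be the analytification of $$Y=\{(x_1,x_2,z,y_1,y_2)\in\Lambda^2\times\mathbb P_\Lambda\times(\Lambda^* )^2\mid x_1z=1+y_1,\ x_2=(1+y_2)z\}$$ over the Novikov field $\Lambda=\mathbb C((T^{\mathbb R}))$, and let $\mathscr Y=\{|x_2|<1\}\subset Y^{\mathrm{an}}$. Let $f=j^{-1}\circ F:\mathscr Y\to\mathbb R^3$, where $j:\mathbb R^3\to\mathbb R^5$ and $F:Y^{\mathrm{an}}\to\mathbb R^5$ are the maps defined in the context. Let $$C_1=\{x_1=x_2=0,\ y_1=-1,\ z=0\},\qquad C_2=\{x_1=x_2=0,\ y_2=-1,\ z=\infty\},$$ which are subvarieties of codimension $2$ in $Y$, and let $$\Delta_1=\{0\}\times\mathbb R\times\{\log c_1\},\qquad \Delta_2=\mathbb R\times\{0\}\times\{\log c_2\}\subset\mathbb R^3 .$$ Then $j(\Delta_1)=F(C_1)$ and $j(\Delta_2)=F(C_2)$; hence $f(C_1)=\Delta_1$ and $f(C_2)=\Delta_2$.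
   Context: **Novikov field.** $\Lambda=\mathbb C((T^{\mathbb R}))=\{\sum_{i\ge0}a_iT^{\lambda_i}\mid a_i\in\mathbb C,\ \lambda_i\in\mathbb R,\ \lambda_i\to+\infty\}$, with valuation $\mathsf v:\Lambda\to\mathbb R\cup\{+\infty\}$ (the smallest exponent with nonzero coefficient) and norm $|x|=e^{-\mathsf v(x)}$. $\mathbb P_\Lambda=\Lambda\cup\{\infty\}$ is the projective line, $\mathsf v(\infty)=-\infty$. The equations of $Y$ are read homogeneously in $z$: near $z=\infty$, with $w=1/z$, they are $x_1=(1+y_1)w$, $1+y_2=x_2w$. **The function $\psi$.** Let $X'=\{(u_1,v_1,u_2,v_2)\in\mathbb C^4\mid u_1v_1-c_1=u_2v_2-c_2\}$, $z=u_iv_i-c_i$, and $X=X'\setminus\{z=0\}\subset\mathbb C^4\times\mathbb C^*$, with $\omega$ the restriction of the standard form $\omega_0=\sum_{k=1,2}\frac i2(du_k\wedge d\bar u_k+dv_k\wedge d\bar v_k)+\frac i2\frac{dz\wedge d\bar z}{|z|^2}$ on $\mathbb C^4\times\mathbb C^*$. For $q=(q_1,q_2,q_3)\in\mathbb R^3$ let $L_q\subset X$ be given by $\frac12(|u_i|^2-|v_i|^2)=q_i$ ($i=1,2$), $\log|z|=q_3$; it is the fiber product over $\mathbb C_z$ of $L_i=\{(u_i,v_i)\in\mathbb C^2\mid\frac12(|u_i|^2-|v_i|^2)=q_i,\ |u_iv_i-c_i|=e^{q_3}\}$, and a disk class in $(X',L_q)$ is written $(\beta_1,\beta_2)$ with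 $\beta_i$ a disk class in $(\mathbb C^2,L_i)$. If $q_3<\log c_i$ ($L_i$ of Chekanov type), let $\hat\beta_i$ be the preferred Maslov-index-2 class, that of disks disjoint from $\{u_iv_i=0\}$; if $q_3>\log c_i$ ($L_i$ of Clifford type), let $\beta_{i+}$ be the Maslov-index-2 class with $\beta_{i+}\cdot\{v_i=0\}=1$. Write $E(\beta)=\frac1{2\pi}\int_\beta\omega$. Then $\psi$ is the function, smooth on $\mathbb R^3\setminus(\Delta_1\cup\Delta_2)$ and continuous on $\mathbb R^3$, equal to $E((\hat\beta_1,\hat\beta_2))$ if $q_3<\log c_2$, to $E((\hat\beta_1,\beta_{2+}))+\min\{0,q_2\}$ if $\log c_2<q_3<\log c_1$, and to $E((\beta_{1+},\beta_{2+}))+\min\{0,q_1\}+\min\{0,q_2\}$ if $q_3>\log c_1$. For fixed $q_1,q_2$, the function $q_3\mapsto\psi(q_1,q_2,q_3)$ is an increasing diffeomorphism from $\mathbb R$ to $(0,+\infty)$. Write $\psi^{(i)}(q_1,q_2)=\psi(q_1,q_2,\log c_i)$. **The map $j$.** $j(q)=(\theta_1(q),\theta_2(q),\vartheta(q),q_1,q_2)$ for $q=(q_1,q_2,q_3)$, a topological embedding, with $\theta_1=\min\{-\psi(q),-\psi^{(1)}(q_1,q_2)\}+\min\{0,q_1\}+\min\{0,q_2\}$, $\theta_2=\min\{\psi(q),\psi^{(2)}(q_1,q_2)\}$, $\vartheta=\mathrm{median}\{\psi(q),\psi^{(1)}(q_1,q_2),\psi^{(2)}(q_1,q_2)\}$.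 **The map $F$.** $F(x_1,x_2,z,y_1,y_2)=(F_1,F_2,G,\mathsf v(y_1),\mathsf v(y_2))$ where, writing $\psi^{(i)}=\psi^{(i)}(\mathsf v(y_1),\mathsf v(y_2))$, $F_1=\min\{\mathsf v(x_1),-\psi^{(1)}+\min\{0,\mathsf v(y_1)\}+\min\{0,\mathsf v(y_2)\}\}$, $F_2=\min\{\mathsf v(x_2),\psi^{(2)}\}$, $G=\mathrm{median}\{\mathsf v(z)+\min\{0,\mathsf v(y_2)\},\psi^{(1)},\psi^{(2)}\}$. One has $F(\mathscr Y)=j(\mathbb R^3)$, so $f=j^{-1}\circ F$ is well defined.
   Formalization: The disks defining ψ meet z=0, so their energy for ω_0 is infinite; 1/|z|² is replaced by an arbitrary continuous ρ(z)≥0. Smoothness of ψ, which fails at q_i=0, is not assumed; the aside that C_1, C_2 have codimension 2 is not proved. *)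

theory Defs
  imports
    "HOL-Complex_Analysis.Winding_Numbers"
    "HOL-Library.Poly_Mapping"
    "HOL-Library.FuncSet"
    "HOL-Library.Extended_Real"
begin

section \<open>The Novikov field\<close>

text \<open>A series is its coefficient function; every left half-line meets the support in a
  finite set, i.e. the exponents form a finite set or a sequence tending to infinity.\<close>

typedef novikov = "{f :: real \<Rightarrow> complex. \<forall>N. finite {l. l \<le> N \<and> f l \<noteq> 0}}"
  morphisms ncoeff Abs_novikov
  by (rule exI[of _ "\<lambda>_. 0"]) simp

setup_lifting type_definition_novikov

lemma novikov_bounded_below:
  assumes "\<forall>N. finite {l::real. l \<le> N \<and> f l \<noteq> (0::complex)}"
  shows "\<exists>B\<ge>0. \<forall>l. f l \<noteq> 0 \<longrightarrow> - B \<le> l"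
proof -
  let ?S = "insert 0 {l. l \<le> 0 \<and> f l \<noteq> 0}"
  have fin: "finite ?S" using assms by simp
  have le: "Min ?S \<le> l" if "f l \<noteq> 0" for l
  proof (cases "l \<le> 0")
    case True
    then show ?thesis using that fin by (intro Min_le) auto
  next
    case False
    moreover have "Min ?S \<le> 0" using fin by (intro Min_le) auto
    ultimately show ?thesis by linarith
  qed
  have "Min ?S \<le> 0" using fin by (intro Min_le) auto
  then show ?thesis using le by (intro exI[of _ "- Min ?S"]) auto
qed

lemma novikov_add:
  fixes f g :: "real \<Rightarrow> complex"
  assumes "\<forall>N. finite {l. l \<le> N \<and> f l \<noteq> 0}" "\<forall>N. finite {l. l \<le> N \<and> g l \<noteq> 0}"
  shows "\<forall>N. finite {l. l \<le> N \<and> f l + g l \<noteq> 0}"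
proof
  fix N
  have "finite ({l. l \<le> N \<and> f l \<noteq> 0} \<union> {l. l \<le> N \<and> g l \<noteq> 0})" using assms by blast
  then show "finite {l. l \<le> N \<and> f l + g l \<noteq> 0}" by (rule rev_finite_subset) auto
qed

definition conv :: "(real \<Rightarrow> complex) \<Rightarrow> (real \<Rightarrow> complex) \<Rightarrow> real \<Rightarrow> complex" where
  "conv f g l = (\<Sum>a\<in>{a. f a \<noteq> 0 \<and> g (l - a) \<noteq> 0}. f a * g (l - a))"

lemma conv_eq_sum:
  assumes "finite A" "{a. f a \<noteq> 0 \<and> g (l - a) \<noteq> 0} \<subseteq> A"
  shows "conv f g l = (\<Sum>a\<in>A. f a * g (l - a))"
  unfolding conv_def using assms by (intro sum.mono_neutral_left) auto

lemma conv_commute: "conv f g = conv g f"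
proof
  fix l
  show "conv f g l = conv g f l"
    unfolding conv_def
    by (rule sum.reindex_bij_witness[of _ "\<lambda>a. l - a" "\<lambda>a. l - a"]) auto
qed

lemma conv_support:
  assumes "conv f g l \<noteq> 0"
  obtains a b where "f a \<noteq> 0" "g b \<noteq> 0" "l = a + b"
proof -
  obtain a where "a \<in> {a. f a \<noteq> 0 \<and> g (l - a) \<noteq> 0}"
    using assms unfolding conv_def by (metis (no_types, lifting) sum.neutral)
  then show ?thesis using that[of a "l - a"] by auto
qed

lemma conv_novikov:
  assumes f: "\<forall>N. finite {l::real. l \<le> N \<and> f l \<noteq> (0::complex)}"
    and g: "\<forall>N. finite {l::real. l \<le> N \<and> g l \<noteq> (0::complex)}"
  shows "finite {l. l \<le> N \<and> conv f g l \<noteq> 0}"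
proof -
  obtain B where B: "B \<ge> 0" "\<And>l. f l \<noteq> 0 \<Longrightarrow> - B \<le> l" using novikov_bounded_below[OF f] by blast
  obtain C where C: "C \<ge> 0" "\<And>l. g l \<noteq> 0 \<Longrightarrow> - C \<le> l" using novikov_bounded_below[OF g] by blast
  let ?P = "{l. l \<le> N + C \<and> f l \<noteq> 0} \<times> {l. l \<le> N + B \<and> g l \<noteq> 0}"
  have "finite ?P" using f g by blast
  moreover have "{l. l \<le> N \<and> conv f g l \<noteq> 0} \<subseteq> (\<lambda>(a, b). a + b) ` ?P"
  proof
    fix l assume "l \<in> {l. l \<le> N \<and> conv f g l \<noteq> 0}"
    then have l: "l \<le> N" "conv f g l \<noteq> 0" by auto
    obtain a b where ab: "f a \<noteq> 0" "g b \<noteq> 0" "l = a + b" using conv_support[OF l(2)] .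
    then have "(a, b) \<in> ?P" using B(2)[of a] C(2)[of b] l(1) by auto
    then show "l \<in> (\<lambda>(a, b). a + b) ` ?P" using ab(3) by force
  qed
  ultimately show ?thesis using finite_surj by blast
qed

lemma conv_add:
  assumes f: "\<forall>N. finite {l::real. l \<le> N \<and> f l \<noteq> (0::complex)}"
    and g: "\<forall>N. finite {l::real. l \<le> N \<and> g l \<noteq> (0::complex)}"
    and h: "\<forall>N. finite {l::real. l \<le> N \<and> h l \<noteq> (0::complex)}"
  shows "conv (\<lambda>x. f x + g x) h l = conv f h l + conv g h l"
proof -
  obtain C where C: "\<And>l. h l \<noteq> 0 \<Longrightarrow> - C \<le> l" using novikov_bounded_below[OF h] by blast
  let ?A = "{a. a \<le> l + C \<and> f a \<noteq> 0} \<union> {a. a \<le> l + C \<and> g a \<noteq> 0}"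
  have fin: "finite ?A" using f g by blast
  have le: "a \<le> l + C" if "h (l - a) \<noteq> 0" for a using C[OF that] by linarith
  have "conv (\<lambda>x. f x + g x) h l = (\<Sum>a\<in>?A. (f a + g a) * h (l - a))"
    by (rule conv_eq_sum[OF fin]) (use le in auto)
  moreover have "conv f h l = (\<Sum>a\<in>?A. f a * h (l - a))"
    by (rule conv_eq_sum[OF fin]) (use le in auto)
  moreover have "conv g h l = (\<Sum>a\<in>?A. g a * h (l - a))"
    by (rule conv_eq_sum[OF fin]) (use le in auto)
  ultimately show ?thesis by (simp add: distrib_right sum.distrib)
qed

lemma conv_assoc:
  assumes f: "\<forall>N. finite {l::real. l \<le> N \<and> f l \<noteq> (0::complex)}"
    and g: "\<forall>N. finite {l::real. l \<le> N \<and> g l \<noteq> (0::complex)}"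
    and h: "\<forall>N. finite {l::real. l \<le> N \<and> h l \<noteq> (0::complex)}"
  shows "conv (conv f g) h l = conv f (conv g h) l"
proof -
  obtain A where A: "A \<ge> 0" "\<And>l. f l \<noteq> 0 \<Longrightarrow> - A \<le> l" using novikov_bounded_below[OF f] by blast
  obtain B where B: "B \<ge> 0" "\<And>l. g l \<noteq> 0 \<Longrightarrow> - B \<le> l" using novikov_bounded_below[OF g] by blast
  obtain C where C: "C \<ge> 0" "\<And>l. h l \<noteq> 0 \<Longrightarrow> - C \<le> l" using novikov_bounded_below[OF h] by blast
  define F where "F = {a. a \<le> l + B + C \<and> f a \<noteq> 0}"
  define H where "H = {c. c \<le> l + A + B \<and> h c \<noteq> 0}"
  have finF: "finite F" and finH: "finite H" unfolding F_def H_def using f h by blast+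
  have fg: "conv f g (l - c) = (\<Sum>a\<in>F. f a * g (l - c - a))" if "c \<in> H" for c
  proof (rule conv_eq_sum[OF finF], rule subsetI)
    fix a assume "a \<in> {a. f a \<noteq> 0 \<and> g (l - c - a) \<noteq> 0}"
    then show "a \<in> F" using B(2)[of "l - c - a"] C(2)[of c] that by (auto simp: F_def H_def)
  qed
  have gh: "conv h g (l - a) = (\<Sum>c\<in>H. h c * g (l - a - c))" if "a \<in> F" for a
  proof (rule conv_eq_sum[OF finH], rule subsetI)
    fix c assume "c \<in> {c. h c \<noteq> 0 \<and> g (l - a - c) \<noteq> 0}"
    then show "c \<in> H" using B(2)[of "l - a - c"] A(2)[of a] that by (auto simp: F_def H_def)
  qed
  have sub1: "{c. h c \<noteq> 0 \<and> conv f g (l - c) \<noteq> 0} \<subseteq> H"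
  proof
    fix c assume "c \<in> {c. h c \<noteq> 0 \<and> conv f g (l - c) \<noteq> 0}"
    then have c: "h c \<noteq> 0" "conv f g (l - c) \<noteq> 0" by auto
    obtain a b where "f a \<noteq> 0" "g b \<noteq> 0" "l - c = a + b" using conv_support[OF c(2)] .
    then show "c \<in> H" using A(2)[of a] B(2)[of b] c(1) by (auto simp: H_def)
  qed
  have sub2: "{a. f a \<noteq> 0 \<and> conv h g (l - a) \<noteq> 0} \<subseteq> F"
  proof
    fix a assume "a \<in> {a. f a \<noteq> 0 \<and> conv h g (l - a) \<noteq> 0}"
    then have a: "f a \<noteq> 0" "conv h g (l - a) \<noteq> 0" by auto
    obtain c b where "h c \<noteq> 0" "g b \<noteq> 0" "l - a = c + b" using conv_support[OF a(2)] .
    then show "a \<in> F" using B(2)[of b] C(2)[of c] a(1) by (auto simp: F_def)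
  qed
  have "conv (conv f g) h l = conv h (conv f g) l" by (simp add: conv_commute)
  also have "\<dots> = (\<Sum>c\<in>H. h c * conv f g (l - c))" by (rule conv_eq_sum[OF finH sub1])
  also have "\<dots> = (\<Sum>c\<in>H. \<Sum>a\<in>F. f a * (h c * g (l - a - c)))"
    by (rule sum.cong) (auto simp: fg sum_distrib_left mult_ac algebra_simps)
  also have "\<dots> = (\<Sum>a\<in>F. \<Sum>c\<in>H. f a * (h c * g (l - a - c)))" by (rule sum.swap)
  also have "\<dots> = (\<Sum>a\<in>F. f a * conv h g (l - a))"
    by (rule sum.cong) (auto simp: gh sum_distrib_left)
  also have "\<dots> = conv f (conv h g) l" by (rule conv_eq_sum[OF finF sub2, symmetric])
  finally show ?thesis by (simp add: conv_commute[of h g])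
qed

instantiation novikov :: comm_ring_1
begin

lift_definition zero_novikov :: novikov is "\<lambda>_. 0" by simp

lift_definition one_novikov :: novikov is "\<lambda>l. if l = 0 then 1 else 0" by simp

lift_definition plus_novikov :: "novikov \<Rightarrow> novikov \<Rightarrow> novikov" is "\<lambda>f g l. f l + g l"
  using novikov_add by blast

lift_definition uminus_novikov :: "novikov \<Rightarrow> novikov" is "\<lambda>f l. - f l" by simp

definition minus_novikov :: "novikov \<Rightarrow> novikov \<Rightarrow> novikov" where
  "minus_novikov x y = x + (- y)"

lift_definition times_novikov :: "novikov \<Rightarrow> novikov \<Rightarrow> novikov" is conv
  using conv_novikov by blast

instance
proof
  fix a b c :: novikov
  show "a * b * c = a * (b * c)" by transfer (rule ext, rule conv_assoc)
  show "a * b = b * a" by transfer (rule conv_commute)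
  show "1 * a = a"
  proof (transfer, rule ext)
    fix f :: "real \<Rightarrow> complex" and l
    have "conv (\<lambda>l. if l = 0 then 1 else 0) f l
        = (\<Sum>x\<in>{0}. (if x = 0 then 1 else 0) * f (l - x))"
      by (rule conv_eq_sum) auto
    then show "conv (\<lambda>l. if l = 0 then 1 else 0) f l = f l" by simp
  qed
  show "(a + b) * c = a * c + b * c" by transfer (rule ext, rule conv_add)
  show "a + b + c = a + (b + c)" by transfer (simp add: add.assoc)
  show "a + b = b + a" by transfer (simp add: add.commute)
  show "0 + a = a" by transfer simp
  show "- a + a = 0" by transfer simp
  show "a - b = a + - b" by (simp add: minus_novikov_def)
  show "(0::novikov) \<noteq> 1"
    by transfer (metis zero_neq_one)
qed

end

definition nval :: "novikov \<Rightarrow> ereal" where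
  "nval x = (INF l\<in>{l. ncoeff x l \<noteq> 0}. ereal l)"

definition nabs :: "novikov \<Rightarrow> real" where
  "nabs x = (if x = 0 then 0 else exp (- real_of_ereal (nval x)))"


section \<open>The function \<open>\<psi>\<close>\<close>

type_synonym cplane2 = "complex \<times> complex"

definition zmap :: "real \<Rightarrow> cplane2 \<Rightarrow> complex" where
  "zmap c = (\<lambda>(u, v). u * v - of_real c)"

definition X' :: "real \<Rightarrow> real \<Rightarrow> (cplane2 \<times> cplane2) set" where
  "X' c1 c2 = {(p1, p2). zmap c1 p1 = zmap c2 p2}"

definition Lfactor :: "real \<Rightarrow> real \<Rightarrow> real \<Rightarrow> cplane2 set" where
  "Lfactor c q s =
     {(u, v). ((cmod u)\<^sup>2 - (cmod v)\<^sup>2) / 2 = q \<and> cmod (zmap c (u, v)) = exp s}"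

definition Lq :: "real \<Rightarrow> real \<Rightarrow> real \<times> real \<times> real \<Rightarrow> (cplane2 \<times> cplane2) set" where
  "Lq c1 c2 = (\<lambda>(q1, q2, q3).
     {((u1, v1), (u2, v2)). ((u1, v1), (u2, v2)) \<in> X' c1 c2 \<and>
        ((cmod u1)\<^sup>2 - (cmod v1)\<^sup>2) / 2 = q1 \<and> ((cmod u2)\<^sup>2 - (cmod v2)\<^sup>2) / 2 = q2 \<and>
        zmap c1 (u1, v1) \<noteq> 0 \<and> ln (cmod (zmap c1 (u1, v1))) = q3})"

definition C1_on_disk :: "(complex \<Rightarrow> 'a::real_normed_vector) \<Rightarrow> bool" where
  "C1_on_disk g \<longleftrightarrow> (\<exists>S g'. open S \<and> cball 0 1 \<subseteq> S \<and>
     (\<forall>x\<in>S. (g has_derivative g' x) (at x)) \<and> (\<forall>h. continuous_on S (\<lambda>x. g' x h)))"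

definition is_disk :: "real \<Rightarrow> real \<Rightarrow> real \<times> real \<times> real \<Rightarrow> (complex \<Rightarrow> cplane2 \<times> cplane2) \<Rightarrow> bool" where
  "is_disk c1 c2 q g \<longleftrightarrow>
     C1_on_disk g \<and> g ` cball 0 1 \<subseteq> X' c1 c2 \<and> g ` sphere 0 1 \<subseteq> Lq c1 c2 q"

text \<open>Jacobian of \<open>f\<close> at \<open>p\<close>: the pullback of \<open>(i/2) dw \<and> d(cnj w)\<close> by \<open>f\<close> is
  \<open>jac f dx \<and> dy\<close>.\<close>

definition jac :: "(complex \<Rightarrow> complex) \<Rightarrow> complex \<Rightarrow> real" where
  "jac f p = Im (cnj (frechet_derivative f (at p) 1) * frechet_derivative f (at p) \<i>)"

text \<open>Energy \<open>1/(2 pi)\<close> times the integral over the disk \<open>g\<close> of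
  \<open>sum_k (i/2) (du_k \<and> d(cnj u_k) + dv_k \<and> d(cnj v_k)) + \<rho>(z) (i/2) dz \<and> d(cnj z)\<close>.
  For \<open>\<rho> z = 1/|z|^2\<close> this is the form on \<open>C^4 x C^*\<close>, but every disk that enters the definition
  of \<open>\<psi>\<close> passes through \<open>z = 0\<close> and would have infinite energy. Hence \<open>\<rho>\<close> is left arbitrary
  among the continuous nonnegative functions on the whole plane; this includes all functions that
  agree with \<open>1/|z|^2\<close> outside a neighbourhood of \<open>0\<close>, and \<open>\<rho> = 0\<close>.\<close>

definition energy :: "(complex \<Rightarrow> real) \<Rightarrow> real \<Rightarrow> (complex \<Rightarrow> cplane2 \<times> cplane2) \<Rightarrow> real" where
  "energy \<rho> c1 g = 1 / (2 * pi) * integral (cball 0 1) (\<lambda>p.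
     jac (\<lambda>x. fst (fst (g x))) p + jac (\<lambda>x. snd (fst (g x))) p +
     jac (\<lambda>x. fst (snd (g x))) p + jac (\<lambda>x. snd (snd (g x))) p +
     \<rho> (zmap c1 (fst (g p))) * jac (\<lambda>x. zmap c1 (fst (g x))) p)"

definition tangent_at :: "cplane2 set \<Rightarrow> cplane2 \<Rightarrow> cplane2 set" where
  "tangent_at L p = {\<xi>. \<exists>\<gamma>. (\<forall>t::real. \<gamma> t \<in> L) \<and> \<gamma> 0 = p \<and>
     (\<gamma> has_vector_derivative \<xi>) (at 0)}"

definition cdet :: "cplane2 \<Rightarrow> cplane2 \<Rightarrow> complex" where
  "cdet \<xi> \<eta> = fst \<xi> * snd \<eta> - snd \<xi> * fst \<eta>"

text \<open>Maslov index of a disk in \<open>C^2\<close> with boundary on a totally real surface \<open>L\<close>: the winding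
  number of the normalised squared determinant of a frame of \<open>TL\<close> along the boundary. Another
  frame multiplies the determinant by a nonzero real function, so the normalised square depends
  only on \<open>TL\<close>; in particular the frame need not close up.\<close>

definition has_maslov_index :: "cplane2 set \<Rightarrow> (complex \<Rightarrow> cplane2) \<Rightarrow> int \<Rightarrow> bool" where
  "has_maslov_index L d k \<longleftrightarrow> (\<exists>e e'. continuous_on {0..1} e \<and> continuous_on {0..1} e' \<and>
     (\<forall>t\<in>{0..1}. e t \<in> tangent_at L (d (circlepath 0 1 t)) \<and>
                 e' t \<in> tangent_at L (d (circlepath 0 1 t)) \<and> cdet (e t) (e' t) \<noteq> 0) \<and>
     winding_number (\<lambda>t. (cdet (e t) (e' t))\<^sup>2 / of_real ((cmod (cdet (e t) (e' t)))\<^sup>2)) 0 = of_int k)"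

text \<open>The next two predicates say that a disk \<open>d\<close> represents the class \<open>\<beta>hat_i\<close>, respectively the class
  \<open>\<beta>_{i+}\<close>. The disks satisfying either one lie in a single class. The intersection number with
  \<open>{v = 0}\<close>, a divisor disjoint from \<open>L\<close>, is the signed number of zeros of \<open>v\<close> on the disk,
  i.e. the winding number of \<open>v\<close> along the boundary.\<close>

definition represents_hat :: "real \<Rightarrow> real \<Rightarrow> real \<Rightarrow> (complex \<Rightarrow> cplane2) \<Rightarrow> bool" where
  "represents_hat c q s d \<longleftrightarrow> has_maslov_index (Lfactor c q s) d 2 \<and>
     (\<forall>\<zeta>\<in>cball 0 1. fst (d \<zeta>) * snd (d \<zeta>) \<noteq> 0)"

definition represents_plus :: "real \<Rightarrow> real \<Rightarrow> real \<Rightarrow> (complex \<Rightarrow> cplane2) \<Rightarrow> bool" where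
  "represents_plus c q s d \<longleftrightarrow> has_maslov_index (Lfactor c q s) d 2 \<and>
     winding_number ((\<lambda>\<zeta>. snd (d \<zeta>)) \<circ> circlepath 0 1) 0 = 1"

text \<open>The energy of a class is the energy of any disk representing it. The three regions are
  dense, so continuity determines \<open>\<psi>\<close>. Smoothness is not required: \<open>energy + min 0 q\<close> has a
  kink \<open>- |q| / 2\<close> at \<open>q = q_i = 0\<close>, \<open>q3 > ln c_i\<close>. Monotonicity in \<open>q3\<close> is a consequence.\<close>

definition is_psi :: "(complex \<Rightarrow> real) \<Rightarrow> real \<Rightarrow> real \<Rightarrow> (real \<times> real \<times> real \<Rightarrow> real) \<Rightarrow> bool" where
  "is_psi \<rho> c1 c2 \<psi> \<longleftrightarrow> continuous_on UNIV \<psi> \<and>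
     (\<forall>q1 q2 q3 g. is_disk c1 c2 (q1, q2, q3) g \<longrightarrow>
        (q3 < ln c2 \<and> represents_hat c1 q1 q3 (fst \<circ> g) \<and> represents_hat c2 q2 q3 (snd \<circ> g)
           \<longrightarrow> \<psi> (q1, q2, q3) = energy \<rho> c1 g) \<and>
        (ln c2 < q3 \<and> q3 < ln c1 \<and>
           represents_hat c1 q1 q3 (fst \<circ> g) \<and> represents_plus c2 q2 q3 (snd \<circ> g)
           \<longrightarrow> \<psi> (q1, q2, q3) = energy \<rho> c1 g + min 0 q2) \<and>
        (ln c1 < q3 \<and> represents_plus c1 q1 q3 (fst \<circ> g) \<and> represents_plus c2 q2 q3 (snd \<circ> g)
           \<longrightarrow> \<psi> (q1, q2, q3) = energy \<rho> c1 g + min 0 q1 + min 0 q2))"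


section \<open>The analytification of \<open>Y\<close>\<close>

datatype coord = X1 | X2 | Z0 | Z1 | Y1 | Y2

text \<open>\<open>[Z0 : Z1]\<close> are homogeneous coordinates on the projective line, \<open>z = Z0 / Z1\<close>.\<close>

type_synonym npoly = "(coord \<Rightarrow>\<^sub>0 nat) \<Rightarrow>\<^sub>0 novikov"

definition Var :: "coord \<Rightarrow> npoly" where
  "Var k = Poly_Mapping.single (Poly_Mapping.single k 1) 1"

definition Const :: "novikov \<Rightarrow> npoly" where
  "Const a = Poly_Mapping.single 0 a"

definition Z_homogeneous :: "nat \<Rightarrow> npoly \<Rightarrow> bool" where
  "Z_homogeneous d p \<longleftrightarrow>
     (\<forall>m\<in>Poly_Mapping.keys p. Poly_Mapping.lookup m Z0 + Poly_Mapping.lookup m Z1 = d)"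

definition mult_seminorm :: "(npoly \<Rightarrow> real) \<Rightarrow> bool" where
  "mult_seminorm \<mu> \<longleftrightarrow> (\<forall>p. 0 \<le> \<mu> p) \<and> (\<forall>a. \<mu> (Const a) = nabs a) \<and>
     (\<forall>p q. \<mu> (p * q) = \<mu> p * \<mu> q) \<and> (\<forall>p q. \<mu> (p + q) \<le> max (\<mu> p) (\<mu> q))"

text \<open>Berkovich points of \<open>Y\<close>, in homogeneous coordinates: multiplicative seminorms on the polynomial
  ring, extending the norm of the base field, with \<open>Z0\<close>, \<open>Z1\<close> not both zero and \<open>y1\<close>, \<open>y2\<close>
  nonzero, that kill the equations \<open>x1 Z0 = (1 + y1) Z1\<close> and \<open>x2 Z1 = (1 + y2) Z0\<close>. Two of them
  give the same point iff they differ by the factor \<open>t^d\<close> in each degree \<open>d\<close> in \<open>(Z0, Z1)\<close>.\<close>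

definition Y_seminorms :: "(npoly \<Rightarrow> real) set" where
  "Y_seminorms = {\<mu>. mult_seminorm \<mu> \<and> \<not> (\<mu> (Var Z0) = 0 \<and> \<mu> (Var Z1) = 0) \<and>
     \<mu> (Var Y1) \<noteq> 0 \<and> \<mu> (Var Y2) \<noteq> 0 \<and>
     \<mu> (Var X1 * Var Z0 - (1 + Var Y1) * Var Z1) = 0 \<and>
     \<mu> (Var X2 * Var Z1 - (1 + Var Y2) * Var Z0) = 0}"

definition scaling_rel :: "((npoly \<Rightarrow> real) \<times> (npoly \<Rightarrow> real)) set" where
  "scaling_rel = {(\<mu>, \<mu>'). \<mu> \<in> Y_seminorms \<and> \<mu>' \<in> Y_seminorms \<and>
     (\<exists>t>0. \<forall>d p. Z_homogeneous d p \<longrightarrow> \<mu>' p = t ^ d * \<mu> p)}"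

type_synonym point = "(npoly \<Rightarrow> real) set"

definition Y_an :: "point set" where
  "Y_an = Y_seminorms // scaling_rel"

text \<open>The points of \<open>Y\<close> with coordinates in the Novikov field, as points of the analytification.\<close>

definition peval :: "(coord \<Rightarrow> novikov) \<Rightarrow> npoly \<Rightarrow> novikov" where
  "peval a p = (\<Sum>m\<in>Poly_Mapping.keys p. Poly_Mapping.lookup p m *
     (\<Prod>k\<in>{X1, X2, Z0, Z1, Y1, Y2}. a k ^ Poly_Mapping.lookup m k))"

definition Y_classical :: "point set" where
  "Y_classical = {P \<in> Y_an. \<exists>a. (\<lambda>p. nabs (peval a p)) \<in> P}"

text \<open>\<open>absval P p\<close> is \<open>|p(P)|\<close>. It is independent of the chosen seminorm when \<open>p\<close> has degree \<open>0\<close>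
  in \<open>(Z0, Z1)\<close>; for homogeneous \<open>p\<close> its vanishing is independent of the choice.\<close>

definition absval :: "point \<Rightarrow> npoly \<Rightarrow> real" where
  "absval P p = (SOME \<mu>. \<mu> \<in> P) p"

definition neg_ln :: "real \<Rightarrow> ereal" where
  "neg_ln r = (if r = 0 then \<infinity> else ereal (- ln r))"

definition v_of :: "coord \<Rightarrow> point \<Rightarrow> ereal" where
  "v_of k P = neg_ln (absval P (Var k))"

definition v_z :: "point \<Rightarrow> ereal" where
  "v_z P = v_of Z0 P - v_of Z1 P"

definition scrY :: "point set" where
  "scrY = {P \<in> Y_an. absval P (Var X2) < 1}"

definition C1 :: "point set" where
  "C1 = {P \<in> Y_an. absval P (Var X1) = 0 \<and> absval P (Var X2) = 0 \<and>
     absval P (Var Y1 + 1) = 0 \<and> absval P (Var Z0) = 0}"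

definition C2 :: "point set" where
  "C2 = {P \<in> Y_an. absval P (Var X1) = 0 \<and> absval P (Var X2) = 0 \<and>
     absval P (Var Y2 + 1) = 0 \<and> absval P (Var Z1) = 0}"


section \<open>The maps \<open>j\<close>, \<open>F\<close> and \<open>f\<close>\<close>

definition median :: "'a::linorder \<Rightarrow> 'a \<Rightarrow> 'a \<Rightarrow> 'a" where
  "median a b c = max (min a b) (min (max a b) c)"

type_synonym R3 = "real \<times> real \<times> real"
type_synonym R5 = "real \<times> real \<times> real \<times> real \<times> real"

definition psi_at :: "(R3 \<Rightarrow> real) \<Rightarrow> real \<Rightarrow> real \<Rightarrow> real \<Rightarrow> real" where
  "psi_at \<psi> c q1 q2 = \<psi> (q1, q2, ln c)"

definition jmap :: "(R3 \<Rightarrow> real) \<Rightarrow> real \<Rightarrow> real \<Rightarrow> R3 \<Rightarrow> R5" where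
  "jmap \<psi> c1 c2 = (\<lambda>(q1, q2, q3).
     (min (- \<psi> (q1, q2, q3)) (- psi_at \<psi> c1 q1 q2) + min 0 q1 + min 0 q2,
      min (\<psi> (q1, q2, q3)) (psi_at \<psi> c2 q1 q2),
      median (\<psi> (q1, q2, q3)) (psi_at \<psi> c1 q1 q2) (psi_at \<psi> c2 q1 q2),
      q1, q2))"

text \<open>All extended reals below to which \<open>real_of_ereal\<close> is applied are finite.\<close>

definition Fmap :: "(R3 \<Rightarrow> real) \<Rightarrow> real \<Rightarrow> real \<Rightarrow> point \<Rightarrow> R5" where
  "Fmap \<psi> c1 c2 P =
     (let a1 = real_of_ereal (v_of Y1 P); a2 = real_of_ereal (v_of Y2 P);
          psi1 = psi_at \<psi> c1 a1 a2; psi2 = psi_at \<psi> c2 a1 a2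
      in (real_of_ereal (min (v_of X1 P) (ereal (- psi1 + min 0 a1 + min 0 a2))),
          real_of_ereal (min (v_of X2 P) (ereal psi2)),
          real_of_ereal (median (v_z P + ereal (min 0 a2)) (ereal psi1) (ereal psi2)),
          a1, a2))"

definition fmap :: "(R3 \<Rightarrow> real) \<Rightarrow> real \<Rightarrow> real \<Rightarrow> point \<Rightarrow> R3" where
  "fmap \<psi> c1 c2 = restrict (inv (jmap \<psi> c1 c2) \<circ> Fmap \<psi> c1 c2) scrY"

definition Delta1 :: "real \<Rightarrow> R3 set" where
  "Delta1 c1 = {0} \<times> UNIV \<times> {ln c1}"

definition Delta2 :: "real \<Rightarrow> R3 set" where
  "Delta2 c2 = UNIV \<times> {0} \<times> {ln c2}"

end

theory Submission
  imports Defs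
begin

text \<open>At a point of \<open>C1\<close> one has \<open>v x1 = v x2 = v z = \<infinity>\<close> and \<open>v y1 = 0\<close>, so \<open>F\<close> takes the value
  \<open>j (0, v y2, ln c1)\<close> as soon as \<open>psi_at \<psi> c2 < psi_at \<psi> c1\<close>, and \<open>y2\<close> may be any monomial \<open>T\<^sup>q\<close>; similarly for \<open>C2\<close>.
  This inequality and the injectivity of \<open>j\<close> both follow from \<open>\<psi>\<close> being strictly increasing in \<open>q3\<close>.
  For that, let \<open>b = exp q3\<close> and \<open>w = c + b \<zeta>\<close>, and take the disks \<open>u = \<surd>(P |w|\<^sup>2)\<close>, \<open>v = w / u\<close>, where
  \<open>P t = q + \<surd>(q\<^sup>2 + t)\<close> except near \<open>t = 0\<close>. They represent the required classes on both sides of the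
  wall \<open>b = c\<close>, and their energy is the integral over \<open>|z| \<le> b\<close> of a positive function of \<open>z\<close> that does
  not depend on \<open>b\<close>. The walls are crossed by continuity of \<open>\<psi>\<close>.\<close>

section \<open>The Novikov norm\<close>

text \<open>Only finitely many exponents lie below a given exponent \<open>k\<close> of the support,
  so the support has a least element.\<close>

lemma novikov_leading:
  assumes "x \<noteq> 0"
  obtains l where "ncoeff x l \<noteq> 0" "\<And>m. ncoeff x m \<noteq> 0 \<Longrightarrow> l \<le> m"
proof -
  obtain k where k: "ncoeff x k \<noteq> 0"
    using assms by (metis ncoeff_inject zero_novikov.rep_eq ext)
  let ?S = "{l. l \<le> k \<and> ncoeff x l \<noteq> 0}"
  have fin: "finite ?S" using ncoeff[of x] by simp
  have "k \<in> ?S" using k by simp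
  then have M: "Min ?S \<in> ?S" using fin by (intro Min_in) auto
  have "Min ?S \<le> m" if "ncoeff x m \<noteq> 0" for m
    using M fin that by (cases "m \<le> k") auto
  then show ?thesis using that[of "Min ?S"] M by auto
qed

lemma nval_eqI:
  assumes "ncoeff x l \<noteq> 0" "\<And>m. ncoeff x m \<noteq> 0 \<Longrightarrow> l \<le> m"
  shows "nval x = ereal l"
  unfolding nval_def using assms by (intro antisym INF_lower2[of l] INF_greatest) auto

lemma nabs_eqI:
  assumes "ncoeff x l \<noteq> 0" "\<And>m. ncoeff x m \<noteq> 0 \<Longrightarrow> l \<le> m"
  shows "nabs x = exp (- l)"
proof -
  have "x \<noteq> 0" using assms(1) by (auto simp: zero_novikov.rep_eq)
  then show ?thesis using nval_eqI[OF assms] by (simp add: nabs_def)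
qed

lemma nabs_0 [simp]: "nabs 0 = 0"
  by (simp add: nabs_def)

lemma nabs_nonneg: "nabs x \<ge> 0"
  by (simp add: nabs_def)

lemma nabs_eq_0_iff [simp]: "nabs x = 0 \<longleftrightarrow> x = 0"
  by (simp add: nabs_def)

text \<open>Translates norm bounds into conditions on the support. It includes \<open>x = 0\<close>,
  where there is no leading exponent, so the ultrametric inequality needs no case split on which
  summand vanishes.\<close>

lemma nabs_le_iff:
  "nabs x \<le> exp (- l) \<longleftrightarrow> (\<forall>m. ncoeff x m \<noteq> 0 \<longrightarrow> l \<le> m)"
proof (cases "x = 0")
  case True
  then show ?thesis by (simp add: zero_novikov.rep_eq)
next
  case False
  then obtain k where k: "ncoeff x k \<noteq> 0" "\<And>m. ncoeff x m \<noteq> 0 \<Longrightarrow> k \<le> m"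
    using novikov_leading by blast
  then show ?thesis using order_trans by (auto simp: nabs_eqI[OF k])
qed

lemma nabs_one [simp]: "nabs 1 = 1"
  using nabs_eqI[of 1 0] by (simp add: one_novikov.rep_eq split: if_splits)

lemma nabs_minus [simp]: "nabs (- x) = nabs x"
  by (simp add: nabs_def nval_def uminus_novikov.rep_eq)

lemma nabs_add: "nabs (x + y) \<le> max (nabs x) (nabs y)"
proof (cases "x = 0 \<and> y = 0")
  case False
  then have "0 < max (nabs x) (nabs y)"
    using nabs_nonneg[of x] nabs_nonneg[of y] by (metis less_max_iff_disj nabs_eq_0_iff order_less_le)
  then obtain l where l: "max (nabs x) (nabs y) = exp (- l)"
    by (metis exp_ln minus_minus)
  have "nabs x \<le> exp (- l)" "nabs y \<le> exp (- l)" using l by (metis max.cobounded1 max.cobounded2)+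
  then have "nabs (x + y) \<le> exp (- l)"
    unfolding nabs_le_iff plus_novikov.rep_eq by (metis add_0)
  then show ?thesis using l by simp
qed auto

lemma nabs_mult: "nabs (x * y) = nabs x * nabs y"
proof (cases "x = 0 \<or> y = 0")
  case False
  obtain k where k: "ncoeff x k \<noteq> 0" "\<And>m. ncoeff x m \<noteq> 0 \<Longrightarrow> k \<le> m"
    using novikov_leading False by blast
  obtain l where l: "ncoeff y l \<noteq> 0" "\<And>m. ncoeff y m \<noteq> 0 \<Longrightarrow> l \<le> m"
    using novikov_leading False by blast
  \<comment> \<open>A contributing index satisfies \<open>a \<ge> k\<close> and
    \<open>k + l - a \<ge> l\<close>, which leaves only \<open>a = k\<close>: the leading terms
    multiply.\<close>
  have "ncoeff (x * y) (k + l) = (\<Sum>a\<in>{k}. ncoeff x a * ncoeff y (k + l - a))"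
    unfolding times_novikov.rep_eq
    by (rule conv_eq_sum) (use k(2) l(2) in force)+
  then have "ncoeff (x * y) (k + l) \<noteq> 0" using k l by simp
  moreover have "k + l \<le> m" if "ncoeff (x * y) m \<noteq> 0" for m
    using that unfolding times_novikov.rep_eq by (rule conv_support) (use k(2) l(2) in force)
  ultimately have "nabs (x * y) = exp (- (k + l))" by (rule nabs_eqI)
  then show ?thesis by (simp add: nabs_eqI[OF k] nabs_eqI[OF l] exp_diff exp_minus field_simps exp_add)
qed auto

text \<open>Provides a nonzero element of each prescribed valuation \<open>e\<close>.\<close>

lift_definition nmonom :: "real \<Rightarrow> novikov" is "\<lambda>e l. if l = e then 1 else 0" by simp

lemma nabs_nmonom: "nabs (nmonom e) = exp (- e)"
  by (rule nabs_eqI) (auto simp: nmonom.rep_eq split: if_splits)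

section \<open>Points of the analytification\<close>

definition mon_eval :: "(coord \<Rightarrow> novikov) \<Rightarrow> (coord \<Rightarrow>\<^sub>0 nat) \<Rightarrow> novikov" where
  "mon_eval a m = (\<Prod>k\<in>{X1, X2, Z0, Z1, Y1, Y2}. a k ^ Poly_Mapping.lookup m k)"

lemma mon_eval_add: "mon_eval a (m + n) = mon_eval a m * mon_eval a n"
  by (simp add: mon_eval_def lookup_add power_add prod.distrib mult_ac)

lemma mon_eval_0 [simp]: "mon_eval a 0 = 1"
  by (simp add: mon_eval_def)

lemma mon_eval_single [simp]: "mon_eval a (Poly_Mapping.single k (Suc 0)) = a k"
  by (cases k) (simp_all add: mon_eval_def lookup_single when_def)

lemma peval_add: "peval a (p + q) = peval a p + peval a q"
  unfolding peval_def
  by (rule setsum_keys_plus_distrib[where f = "\<lambda>m c. c * _ m"]) (simp_all add: distrib_right)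

lemma peval_single: "peval a (Poly_Mapping.single m c) = c * mon_eval a m"
  by (simp add: peval_def mon_eval_def)

text \<open>A polynomial is a finite sum of monomials, so additive statements need checking on
  monomials only.\<close>

lemma poly_mapping_single_induct [case_names zero single add]:
  fixes p :: "'a \<Rightarrow>\<^sub>0 'b::monoid_add"
  assumes "P 0" "\<And>m c. P (Poly_Mapping.single m c)" "\<And>p q. P p \<Longrightarrow> P q \<Longrightarrow> P (p + q)"
  shows "P p"
proof (induction p rule: update_induct)
  case const
  show ?case by (rule assms(1))
next
  case (update p m c)
  \<comment> \<open>The updated key lies outside the support of \<open>p\<close>, so the update is
    an addition.\<close>
  have "Poly_Mapping.update m c p = p + Poly_Mapping.single m c"
    using update(1) by (intro poly_mapping_eqI) (auto simp: lookup_update lookup_add lookup_single in_keys_iff when_def)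
  then show ?case using assms(2,3) update by metis
qed

lemma peval_0 [simp]: "peval a 0 = 0"
  by (simp add: peval_def)

text \<open>Both sides are biadditive; two inductions reduce the claim to a pair of monomials, where
  exponents add.\<close>

lemma peval_mult: "peval a (p * q) = peval a p * peval a q"
proof (induction p rule: poly_mapping_single_induct)
  case (single m c)
  show ?case
  proof (induction q rule: poly_mapping_single_induct)
    case (single n d)
    then show ?case by (simp add: mult_single peval_single mon_eval_add mult_ac)
  qed (simp_all add: distrib_left peval_add)
qed (simp_all add: distrib_right peval_add)

lemma peval_Const [simp]: "peval a (Const c) = c"
  by (simp add: Const_def peval_single)

lemma peval_Var [simp]: "peval a (Var k) = a k"
  by (simp add: Var_def peval_single)

lemma peval_1 [simp]: "peval a 1 = 1"
  using peval_Const[of a 1] by (simp add: Const_def)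

lemma peval_minus: "peval a (p - q) = peval a p - peval a q"
  by (metis add_diff_cancel diff_add_cancel peval_add)

lemma mult_seminorm_peval: "mult_seminorm (\<lambda>p. nabs (peval a p))"
  by (simp add: mult_seminorm_def nabs_nonneg peval_mult nabs_mult peval_add nabs_add)

lemma peval_in_Y_seminorms:
  assumes "a Z0 \<noteq> 0 \<or> a Z1 \<noteq> 0" "a Y1 \<noteq> 0" "a Y2 \<noteq> 0"
    "a X1 * a Z0 = (1 + a Y1) * a Z1" "a X2 * a Z1 = (1 + a Y2) * a Z0"
  shows "(\<lambda>p. nabs (peval a p)) \<in> Y_seminorms"
  using assms by (simp add: Y_seminorms_def mult_seminorm_peval peval_minus peval_mult peval_add)

section \<open>Seminorms representing a Berkovich point\<close>

lemma scaling_rel_refl: "\<mu> \<in> Y_seminorms \<Longrightarrow> (\<mu>, \<mu>) \<in> scaling_rel"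
  by (auto simp: scaling_rel_def intro: exI[of _ 1])

text \<open>Reflexivity makes the class nonempty, so the choice inside \<open>absval\<close> really
  picks a member of it.\<close>

lemma absval_in_Y_seminorms:
  assumes "P \<in> Y_an"
  shows "absval P \<in> Y_seminorms"
proof -
  obtain \<mu> where \<mu>: "\<mu> \<in> Y_seminorms" "P = scaling_rel `` {\<mu>}"
    using assms by (auto simp: Y_an_def quotient_def)
  then have "\<mu> \<in> P" using scaling_rel_refl by auto
  then have "(SOME \<mu>. \<mu> \<in> P) \<in> P" by (rule someI[of "\<lambda>\<mu>. \<mu> \<in> P"])
  moreover have "absval P = (SOME \<mu>. \<mu> \<in> P)" by (simp add: absval_def fun_eq_iff)
  ultimately show ?thesis using \<mu> by (auto simp: scaling_rel_def)
qed

text \<open>The chosen representative is known only up to a scaling factor \<open>t\<close>; it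
  drops out in degree 0 and does not affect vanishing.\<close>

lemma absval_class:
  assumes "\<mu> \<in> Y_seminorms"
  obtains t where "t > 0"
    "\<And>d p. Z_homogeneous d p \<Longrightarrow> absval (scaling_rel `` {\<mu>}) p = t ^ d * \<mu> p"
proof -
  let ?P = "scaling_rel `` {\<mu>}"
  have "\<mu> \<in> ?P" using scaling_rel_refl[OF assms] by auto
  then have "(SOME \<mu>. \<mu> \<in> ?P) \<in> ?P" by (rule someI[of "\<lambda>\<mu>. \<mu> \<in> ?P"])
  moreover have "absval ?P = (SOME \<mu>. \<mu> \<in> ?P)" by (simp only: absval_def fun_eq_iff) simp
  ultimately have "(\<mu>, absval ?P) \<in> scaling_rel" by simp
  then show ?thesis using that by (auto simp: scaling_rel_def)
qed

lemma Z_homogeneous_Var: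
  "Z_homogeneous (if k = Z0 \<or> k = Z1 then 1 else 0) (Var k)"
  by (auto simp: Z_homogeneous_def Var_def lookup_single when_def)

lemma Z_homogeneous_Var_plus_1:
  assumes "k \<noteq> Z0" "k \<noteq> Z1"
  shows "Z_homogeneous 0 (Var k + 1)"
  unfolding Z_homogeneous_def
proof
  fix m assume "m \<in> Poly_Mapping.keys (Var k + 1)"
  then have "m \<in> Poly_Mapping.keys (Var k) \<union> Poly_Mapping.keys (1 :: npoly)"
    using keys_add[of "Var k" 1] by blast
  then show "Poly_Mapping.lookup m Z0 + Poly_Mapping.lookup m Z1 = 0"
    using assms by (auto simp: Var_def lookup_single when_def)
qed

text \<open>The ultrametric inequality is applied to \<open>y = (y + 1) - 1\<close> and to
  \<open>1 = (y + 1) - y\<close>. This works at every Berkovich point, not only at classical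
  ones.\<close>

lemma absval_Var_eq_1:
  assumes "P \<in> Y_an" "absval P (Var k + 1) = 0"
  shows "absval P (Var k) = 1"
proof -
  let ?\<mu> = "absval P"
  have \<mu>: "mult_seminorm ?\<mu>" using absval_in_Y_seminorms[OF assms(1)] by (simp add: Y_seminorms_def)
  have tri: "?\<mu> (p + q) \<le> max (?\<mu> p) (?\<mu> q)" and mult: "?\<mu> (p * q) = ?\<mu> p * ?\<mu> q"
    and C: "?\<mu> (Const a) = nabs a" and nn: "?\<mu> p \<ge> 0" for p q a
    using \<mu> by (auto simp: mult_seminorm_def)
  have one: "?\<mu> 1 = 1" using C[of 1] by (simp add: Const_def)
  have "Const (- 1) = - 1" by (simp add: Const_def single_uminus)
  then have m1: "?\<mu> (- 1) = 1" using C[of "- 1"] by simp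
  have neg: "?\<mu> (- p) = ?\<mu> p" for p using mult[of "- 1" p] m1 by simp
  show ?thesis
  proof (rule antisym)
    show "?\<mu> (Var k) \<le> 1" using tri[of "Var k + 1" "- 1"] assms(2) m1 by simp
    show "1 \<le> ?\<mu> (Var k)" using tri[of "Var k + 1" "- Var k"] assms(2) one neg[of "Var k"] nn[of "Var k"] by simp
  qed
qed

section \<open>The disks\<close>

text \<open>\<open>q + sqrt (q\<^sup>2 + t)\<close> is the value of \<open>|u|\<^sup>2\<close> forced by \<open>(|u|\<^sup>2 - |v|\<^sup>2) / 2 = q\<close> and \<open>|u v|\<^sup>2 = t\<close>. For
  \<open>q \<le> 0\<close> it vanishes at \<open>t = 0\<close>; \<open>prof\<close> replaces it by its tangent line for \<open>t \<le> \<epsilon>\<close>, which keeps it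
  positive and continuously differentiable. \<open>dens\<close> is the derivative of \<open>t / prof \<epsilon> q t\<close>.\<close>

definition prad :: "real \<Rightarrow> real \<Rightarrow> real \<Rightarrow> real" where
  "prad \<epsilon> q t = sqrt (q\<^sup>2 + max t \<epsilon>)"

definition prof :: "real \<Rightarrow> real \<Rightarrow> real \<Rightarrow> real" where
  "prof \<epsilon> q t = q + prad \<epsilon> q t + (t - max t \<epsilon>) / (2 * prad \<epsilon> q t)"

definition dens :: "real \<Rightarrow> real \<Rightarrow> real \<Rightarrow> real" where
  "dens \<epsilon> q t = (q + prad \<epsilon> q t)\<^sup>2 / (2 * prad \<epsilon> q t) / (prof \<epsilon> q t)\<^sup>2"

lemma prad_sq: "\<epsilon> > 0 \<Longrightarrow> (prad \<epsilon> q t)\<^sup>2 = q\<^sup>2 + max t \<epsilon>"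
  by (simp add: prad_def)

lemma prad_pos: "\<epsilon> > 0 \<Longrightarrow> prad \<epsilon> q t > 0"
  unfolding prad_def by (simp add: add_nonneg_pos less_max_iff_disj)

lemma prad_gt: "\<epsilon> > 0 \<Longrightarrow> q + prad \<epsilon> q t > 0"
proof -
  assume "\<epsilon> > 0"
  have "\<bar>q\<bar> < prad \<epsilon> q t"
    unfolding prad_def by (rule real_less_rsqrt) (use \<open>\<epsilon> > 0\<close> in auto)
  then show ?thesis by linarith
qed

text \<open>Over the common denominator, \<open>prad_sq\<close> cancels
  \<open>max t \<epsilon>\<close>. For \<open>t \<ge> 0\<close> the first summand is nonnegative and
  the second is positive, whatever the sign of \<open>q\<close>.\<close>

lemma prof_eq:
  assumes "\<epsilon> > 0"
  shows "prof \<epsilon> q t = t / (2 * prad \<epsilon> q t) + (q + prad \<epsilon> q t)\<^sup>2 / (2 * prad \<epsilon> q t)"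
proof -
  have "2 * prad \<epsilon> q t * prof \<epsilon> q t = t + (q + prad \<epsilon> q t)\<^sup>2"
    using prad_sq[OF assms, of q t] prad_pos[OF assms, of q t]
    unfolding prof_def by (simp add: power2_eq_square field_simps)
  then show ?thesis using prad_pos[OF assms, of q t]
    by (simp add: field_simps)
qed

lemma prof_pos:
  assumes "\<epsilon> > 0" "t \<ge> 0"
  shows "prof \<epsilon> q t > 0"
  unfolding prof_eq[OF assms(1)]
  using prad_pos[OF assms(1), of q t] prad_gt[OF assms(1), of q t] assms(2)
  by (intro add_nonneg_pos divide_nonneg_pos divide_pos_pos) auto

lemma dens_pos:
  assumes "\<epsilon> > 0" "t \<ge> 0"
  shows "dens \<epsilon> q t > 0"
  unfolding dens_def
  using prad_pos[OF assms(1), of q t] prad_gt[OF assms(1), of q t] prof_pos[OF assms, of q]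
  by auto

text \<open>The quotient rule for \<open>t / prof \<epsilon> q t\<close>, as \<open>prof\<close> has
  derivative \<open>1 / (2 * prad \<epsilon> q t)\<close>. The Jacobian of the disk appears in this
  form, while the defining form of \<open>dens\<close> shows positivity.\<close>

lemma dens_eq:
  assumes "\<epsilon> > 0" "t \<ge> 0"
  shows "dens \<epsilon> q t = 1 / prof \<epsilon> q t - t / (2 * prad \<epsilon> q t) / (prof \<epsilon> q t)\<^sup>2"
proof -
  have "(q + prad \<epsilon> q t)\<^sup>2 / (2 * prad \<epsilon> q t) = prof \<epsilon> q t - t / (2 * prad \<epsilon> q t)"
    unfolding prof_eq[OF assms(1)] by simp
  then show ?thesis
    unfolding dens_def using prof_pos[OF assms, of q]
    by (simp add: diff_divide_distrib power2_eq_square)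
qed

lemma continuous_on_prad [continuous_intros]:
  "continuous_on S f \<Longrightarrow> continuous_on S (\<lambda>x. prad \<epsilon> q (f x))"
  unfolding prad_def by (intro continuous_intros)

lemma continuous_on_prof [continuous_intros]:
  "\<epsilon> > 0 \<Longrightarrow> continuous_on S f \<Longrightarrow> continuous_on S (\<lambda>x. prof \<epsilon> q (f x))"
  unfolding prof_def using prad_pos by (intro continuous_intros) (auto simp: less_imp_neq[symmetric])

lemma continuous_on_dens [continuous_intros]:
  assumes "\<epsilon> > 0" "continuous_on S f" "\<And>x. x \<in> S \<Longrightarrow> f x \<ge> 0"
  shows "continuous_on S (\<lambda>x. dens \<epsilon> q (f x))"
  unfolding dens_def using prad_pos[OF assms(1)] prof_pos[OF assms(1)]
  by (intro continuous_intros assms) (auto simp: less_imp_neq[symmetric] assms(3) dest: less_imp_neq)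

text \<open>The root and its tangent line agree at \<open>t = \<epsilon>\<close> in value and in
  derivative, so the derivatives on the two closed half-lines glue.\<close>

lemma DERIV_prof:
  assumes "\<epsilon> > 0"
  shows "(prof \<epsilon> q has_real_derivative 1 / (2 * prad \<epsilon> q t)) (at t)"
proof -
  let ?r = "sqrt (q\<^sup>2 + \<epsilon>)"
  let ?f = "\<lambda>t. q + sqrt (q\<^sup>2 + t)" and ?g = "\<lambda>t. q + ?r + (t - \<epsilon>) / (2 * ?r)"
  have r: "?r > 0" using assms by (simp add: add_nonneg_pos)
  have "((\<lambda>t. if t \<in> {\<epsilon>..} then ?f t else ?g t) has_vector_derivative
      (if t \<in> {\<epsilon>..} then 1 / (2 * sqrt (q\<^sup>2 + t)) else 1 / (2 * ?r))) (at t within {\<epsilon>..} \<union> {..\<epsilon>})"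
  proof (rule has_vector_derivative_If_within_closures)
    show "{\<epsilon>..} \<union> {..\<epsilon>} = {\<epsilon>..} \<union> {..\<epsilon>}" ..
    show "(?f has_vector_derivative 1 / (2 * sqrt (q\<^sup>2 + t))) (at t within {\<epsilon>..} \<union> closure {\<epsilon>..} \<inter> closure {..\<epsilon>})"
      if "t \<in> {\<epsilon>..} \<union> closure {\<epsilon>..} \<inter> closure {..\<epsilon>}"
    proof -
      have "q\<^sup>2 + t > 0" using that assms by (auto simp: add_nonneg_pos)
      then have "(?f has_real_derivative 1 / (2 * sqrt (q\<^sup>2 + t))) (at t)"
        by (auto intro!: derivative_eq_intros simp: field_simps)
      then show ?thesis
        using has_vector_derivative_at_within has_real_derivative_iff_has_vector_derivative by blast
    qed
    show "(?g has_vector_derivative 1 / (2 * ?r)) (at t within {..\<epsilon>} \<union> closure {\<epsilon>..} \<inter> closure {..\<epsilon>})"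
    proof -
      have "(?g has_real_derivative 1 / (2 * ?r)) (at t)"
        using r by (auto intro!: derivative_eq_intros simp: field_simps)
      then show ?thesis
        using has_vector_derivative_at_within has_real_derivative_iff_has_vector_derivative by blast
    qed
  qed auto
  moreover have "{\<epsilon>..} \<union> {..\<epsilon>} = UNIV" by auto
  moreover have "(\<lambda>t. if t \<in> {\<epsilon>..} then ?f t else ?g t) = prof \<epsilon> q"
    by (auto simp: fun_eq_iff prof_def prad_def max_def)
  moreover have "(if t \<in> {\<epsilon>..} then 1 / (2 * sqrt (q\<^sup>2 + t)) else 1 / (2 * ?r)) = 1 / (2 * prad \<epsilon> q t)"
    by (auto simp: prad_def max_def)
  ultimately show ?thesis by (simp add: has_real_derivative_iff_has_vector_derivative)
qed

section \<open>The disks in one factor and their derivatives\<close>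

definition disk_w :: "real \<Rightarrow> real \<Rightarrow> complex \<Rightarrow> complex" where
  "disk_w c b \<zeta> = of_real c + of_real b * \<zeta>"

definition disk_u :: "real \<Rightarrow> real \<Rightarrow> real \<Rightarrow> real \<Rightarrow> complex \<Rightarrow> real" where
  "disk_u \<epsilon> q c b \<zeta> = sqrt (prof \<epsilon> q ((cmod (disk_w c b \<zeta>))\<^sup>2))"

text \<open>The product of the components is \<open>c + b * \<zeta>\<close> whatever the profile.
  Hence \<open>z = b * \<zeta>\<close> on either factor, and a pair of such disks with the same
  \<open>b\<close> lies in \<open>X'\<close>.\<close>

definition disk :: "real \<Rightarrow> real \<Rightarrow> real \<Rightarrow> real \<Rightarrow> complex \<Rightarrow> cplane2" where
  "disk \<epsilon> q c b \<zeta> = (of_real (disk_u \<epsilon> q c b \<zeta>), disk_w c b \<zeta> / of_real (disk_u \<epsilon> q c b \<zeta>))"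

text \<open>The chain rule for the square root of \<open>prof\<close> at the squared modulus of
  \<open>w\<close>; the inner product with \<open>h\<close> is the real differential of that
  modulus.\<close>

definition disk_du :: "real \<Rightarrow> real \<Rightarrow> real \<Rightarrow> real \<Rightarrow> complex \<Rightarrow> complex \<Rightarrow> real" where
  "disk_du \<epsilon> q c b \<zeta> h = b * (disk_w c b \<zeta> \<bullet> h) /
     (2 * prad \<epsilon> q ((cmod (disk_w c b \<zeta>))\<^sup>2) * disk_u \<epsilon> q c b \<zeta>)"

definition disk_dv :: "real \<Rightarrow> real \<Rightarrow> real \<Rightarrow> real \<Rightarrow> complex \<Rightarrow> complex \<Rightarrow> complex" where
  "disk_dv \<epsilon> q c b \<zeta> h = of_real b * h / of_real (disk_u \<epsilon> q c b \<zeta>)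
     - disk_w c b \<zeta> * of_real (disk_du \<epsilon> q c b \<zeta> h) / (of_real (disk_u \<epsilon> q c b \<zeta>))\<^sup>2"

lemma disk_u_pos: "\<epsilon> > 0 \<Longrightarrow> disk_u \<epsilon> q c b \<zeta> > 0"
  by (simp add: disk_u_def prof_pos)

lemma disk_u_sq: "\<epsilon> > 0 \<Longrightarrow> (disk_u \<epsilon> q c b \<zeta>)\<^sup>2 = prof \<epsilon> q ((cmod (disk_w c b \<zeta>))\<^sup>2)"
  by (simp add: disk_u_def prof_pos less_imp_le)

lemma disk_prod: "\<epsilon> > 0 \<Longrightarrow> fst (disk \<epsilon> q c b \<zeta>) * snd (disk \<epsilon> q c b \<zeta>) = disk_w c b \<zeta>"
  using disk_u_pos[of \<epsilon> q c b \<zeta>] by (simp add: disk_def)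

lemma zmap_disk: "\<epsilon> > 0 \<Longrightarrow> zmap c (disk \<epsilon> q c b \<zeta>) = of_real b * \<zeta>"
  using disk_prod[of \<epsilon> q c b \<zeta>] by (simp add: zmap_def split_beta disk_w_def)

lemma continuous_on_disk_w [continuous_intros]:
  "continuous_on S f \<Longrightarrow> continuous_on S (\<lambda>x. disk_w c b (f x))"
  unfolding disk_w_def by (intro continuous_intros)

lemma continuous_on_disk_u [continuous_intros]:
  "\<epsilon> > 0 \<Longrightarrow> continuous_on S f \<Longrightarrow> continuous_on S (\<lambda>x. disk_u \<epsilon> q c b (f x))"
  unfolding disk_u_def by (intro continuous_intros)

lemma disk_w_deriv: "(disk_w c b has_derivative (\<lambda>h. of_real b * h)) (at \<zeta>)"
  unfolding disk_w_def by (auto intro!: derivative_eq_intros)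

lemma disk_u_deriv:
  assumes "\<epsilon> > 0"
  shows "(disk_u \<epsilon> q c b has_derivative disk_du \<epsilon> q c b \<zeta>) (at \<zeta>)"
proof -
  let ?N = "\<lambda>\<zeta>. (cmod (disk_w c b \<zeta>))\<^sup>2"
  have N: "(?N has_derivative (\<lambda>h. 2 * b * (disk_w c b \<zeta> \<bullet> h))) (at \<zeta>)"
    unfolding power2_norm_eq_inner
    by (auto intro!: derivative_eq_intros disk_w_deriv simp: fun_eq_iff inner_complex_def algebra_simps)
  have "((\<lambda>x. prof \<epsilon> q (?N x)) has_derivative
      (\<lambda>h. (2 * b * (disk_w c b \<zeta> \<bullet> h)) * (1 / (2 * prad \<epsilon> q (?N \<zeta>))))) (at \<zeta>)"
    by (rule DERIV_compose_FDERIV[OF DERIV_prof[OF assms] N])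
  then have "((\<lambda>x. sqrt (prof \<epsilon> q (?N x))) has_derivative
      (\<lambda>h. (2 * b * (disk_w c b \<zeta> \<bullet> h)) * (1 / (2 * prad \<epsilon> q (?N \<zeta>))) *
        (inverse (sqrt (prof \<epsilon> q (?N \<zeta>))) / 2))) (at \<zeta>)"
    by (intro DERIV_compose_FDERIV[OF DERIV_real_sqrt]) (use prof_pos[OF assms] in auto)
  moreover have "disk_u \<epsilon> q c b = (\<lambda>x. sqrt (prof \<epsilon> q (?N x)))"
    by (simp add: fun_eq_iff disk_u_def)
  moreover have "disk_du \<epsilon> q c b \<zeta> = (\<lambda>h. (2 * b * (disk_w c b \<zeta> \<bullet> h)) * (1 / (2 * prad \<epsilon> q (?N \<zeta>))) *
        (inverse (sqrt (prof \<epsilon> q (?N \<zeta>))) / 2))"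
    by (simp add: fun_eq_iff disk_du_def disk_u_def field_simps)
  ultimately show ?thesis by simp
qed

lemma disk_v_deriv:
  assumes "\<epsilon> > 0"
  shows "((\<lambda>\<zeta>. disk_w c b \<zeta> / of_real (disk_u \<epsilon> q c b \<zeta>)) has_derivative disk_dv \<epsilon> q c b \<zeta>) (at \<zeta>)"
proof -
  show ?thesis
    using disk_u_pos[OF assms, of q c b \<zeta>]
    by (auto intro!: derivative_eq_intros disk_w_deriv disk_u_deriv[OF assms]
        simp: fun_eq_iff disk_dv_def field_simps power2_eq_square)
qed

lemma disk_deriv:
  assumes "\<epsilon> > 0"
  shows "(disk \<epsilon> q c b has_derivative (\<lambda>h. (of_real (disk_du \<epsilon> q c b \<zeta> h), disk_dv \<epsilon> q c b \<zeta> h))) (at \<zeta>)"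
  unfolding disk_def
  using bounded_linear.has_derivative[OF bounded_linear_of_real disk_u_deriv[OF assms]] disk_v_deriv[OF assms]
  by (intro has_derivative_Pair)

lemma continuous_on_disk_du [continuous_intros]:
  assumes "\<epsilon> > 0" "continuous_on S f" "continuous_on S g"
  shows "continuous_on S (\<lambda>x. disk_du \<epsilon> q c b (f x) (g x))"
proof -
  have "prad \<epsilon> q t * disk_u \<epsilon> q c b x \<noteq> 0" for t x
    using disk_u_pos[OF assms(1), of q c b x] prad_pos[OF assms(1), of q t] by auto
  then show ?thesis unfolding disk_du_def by (intro continuous_intros assms) auto
qed

lemma continuous_on_disk_dv [continuous_intros]:
  assumes "\<epsilon> > 0" "continuous_on S f" "continuous_on S g"
  shows "continuous_on S (\<lambda>x. disk_dv \<epsilon> q c b (f x) (g x))"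
proof -
  have "disk_u \<epsilon> q c b x \<noteq> 0" for x
    using disk_u_pos[OF assms(1), of q c b x] by auto
  then show ?thesis unfolding disk_dv_def by (intro continuous_intros assms) auto
qed

section \<open>Pulled back area forms\<close>

lemma jac_eq:
  assumes "(f has_derivative D) (at p)"
  shows "jac f p = Im (cnj (D 1) * D \<i>)"
  using frechet_derivative_at[OF assms] by (simp add: jac_def)

text \<open>The first component is real valued, so its image carries no area.\<close>

lemma jac_disk_u:
  assumes "\<epsilon> > 0"
  shows "jac (\<lambda>\<zeta>. fst (disk \<epsilon> q c b \<zeta>)) p = 0"
proof -
  have "((\<lambda>\<zeta>. fst (disk \<epsilon> q c b \<zeta>)) has_derivative (\<lambda>h. of_real (disk_du \<epsilon> q c b p h))) (at p)"
    using has_derivative_fst[OF disk_deriv[OF assms]] by simp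
  from jac_eq[OF this] show ?thesis by simp
qed

text \<open>As a function of \<open>w\<close>, the second component is \<open>w\<close> times a
  positive function of \<open>t = |w|^2\<close>. The area density of such a map is the derivative of
  its squared modulus \<open>t / prof \<epsilon> q t\<close> in \<open>t\<close>; the factor
  \<open>b\<^sup>2\<close> comes from \<open>w = c + b * \<zeta>\<close>.\<close>

lemma jac_disk_v:
  assumes "\<epsilon> > 0"
  shows "jac (\<lambda>\<zeta>. snd (disk \<epsilon> q c b \<zeta>)) p = b\<^sup>2 * dens \<epsilon> q ((cmod (disk_w c b p))\<^sup>2)"
proof -
  have D: "((\<lambda>\<zeta>. snd (disk \<epsilon> q c b \<zeta>)) has_derivative disk_dv \<epsilon> q c b p) (at p)"
    using has_derivative_snd[OF disk_deriv[OF assms]] by simp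
  define w U where "w = disk_w c b p" and "U = disk_u \<epsilon> q c b p"
  define r where "r = prad \<epsilon> q ((cmod w)\<^sup>2)"
  define k where "k = b / (2 * r * U)"
  have U: "U > 0" and r: "r > 0" unfolding U_def r_def using disk_u_pos prad_pos assms by auto
  have "jac (\<lambda>\<zeta>. snd (disk \<epsilon> q c b \<zeta>)) p =
      Im (cnj (of_real (b / U) - w * of_real (k * Re w / U\<^sup>2)) * (\<i> * of_real (b / U) - w * of_real (k * Im w / U\<^sup>2)))"
    unfolding jac_eq[OF D] disk_dv_def disk_du_def U_def[symmetric] w_def[symmetric] r_def[symmetric] k_def
    by (simp add: inner_complex_def mult_ac)
  also have "\<dots> = (b / U)\<^sup>2 - (b / U) * (k / U\<^sup>2) * ((Re w)\<^sup>2 + (Im w)\<^sup>2)"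
    by (simp add: algebra_simps power2_eq_square)
  also have "\<dots> = b\<^sup>2 * (1 / U\<^sup>2 - (cmod w)\<^sup>2 / (2 * r) / (U\<^sup>2)\<^sup>2)"
    unfolding cmod_power2 k_def using U r by (simp add: field_simps power2_eq_square)
  finally show ?thesis
    unfolding dens_eq[OF assms zero_le_power2] U_def w_def r_def disk_u_sq[OF assms] .
qed

section \<open>Regularity and boundary conditions\<close>

lemma C1_on_disk_pair:
  assumes "\<epsilon> > 0"
  shows "C1_on_disk (\<lambda>\<zeta>. (disk \<epsilon> q1 c1 b \<zeta>, disk \<epsilon> q2 c2 b \<zeta>))"
  unfolding C1_on_disk_def
  by (rule exI[of _ UNIV], rule exI[of _ "\<lambda>\<zeta> h. ((of_real (disk_du \<epsilon> q1 c1 b \<zeta> h), disk_dv \<epsilon> q1 c1 b \<zeta> h),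
      (of_real (disk_du \<epsilon> q2 c2 b \<zeta> h), disk_dv \<epsilon> q2 c2 b \<zeta> h))"])
     (auto intro!: has_derivative_Pair disk_deriv continuous_intros assms)

text \<open>On the unit circle \<open>|w| \<ge> |b - c|\<close>, so the bound on
  \<open>\<epsilon>\<close> puts the boundary where \<open>prof\<close> is the exact square root
  formula. There \<open>|u|^2 = q + r\<close> and \<open>|v|^2 = r - q\<close> with \<open>r\<close>
  the value of \<open>prad\<close>.\<close>

lemma disk_moment_map:
  assumes "\<epsilon> > 0" "\<epsilon> \<le> (b - c)\<^sup>2" "b > 0" "c > 0" "cmod \<zeta> = 1"
  shows "((cmod (fst (disk \<epsilon> q c b \<zeta>)))\<^sup>2 - (cmod (snd (disk \<epsilon> q c b \<zeta>)))\<^sup>2) / 2 = q"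
proof -
  let ?t = "(cmod (disk_w c b \<zeta>))\<^sup>2"
  define r where "r = prad \<epsilon> q ?t"
  have "\<bar>c - b\<bar> \<le> cmod (disk_w c b \<zeta>)"
    using norm_triangle_ineq3[of "complex_of_real c" "- (of_real b * \<zeta>)"] assms
    by (simp add: disk_w_def norm_mult)
  then have "\<bar>b - c\<bar>\<^sup>2 \<le> ?t" by (intro power_mono) auto
  then have le: "\<epsilon> \<le> ?t" using assms(2) by simp
  have r2: "?t = r\<^sup>2 - q\<^sup>2" using prad_sq[OF assms(1), of q ?t] le by (simp add: max_def r_def)
  have qr: "q + r > 0" unfolding r_def by (rule prad_gt[OF assms(1)])
  have U: "(disk_u \<epsilon> q c b \<zeta>)\<^sup>2 = q + r"
    unfolding disk_u_sq[OF assms(1)] prof_def r_def using le by (simp add: max_def)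
  have "(cmod (snd (disk \<epsilon> q c b \<zeta>)))\<^sup>2 = ?t / (q + r)"
    by (simp add: disk_def norm_divide power_divide U)
  also have "\<dots> = r - q" unfolding r2 using qr by (simp add: field_simps power2_eq_square)
  finally have "(cmod (snd (disk \<epsilon> q c b \<zeta>)))\<^sup>2 = r - q" .
  moreover have "(cmod (fst (disk \<epsilon> q c b \<zeta>)))\<^sup>2 = q + r" using U by (simp add: disk_def)
  ultimately show ?thesis by simp
qed

lemma disk_in_Lfactor:
  assumes "\<epsilon> > 0" "\<epsilon> \<le> (b - c)\<^sup>2" "b > 0" "c > 0" "cmod \<zeta> = 1"
  shows "disk \<epsilon> q c b \<zeta> \<in> Lfactor c q (ln b)"
  using disk_moment_map[OF assms, of q] zmap_disk[OF assms(1), of c q b \<zeta>] assms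
  by (simp add: Lfactor_def case_prod_beta norm_mult)

lemma is_disk_pair:
  assumes "\<epsilon> > 0" "\<epsilon> \<le> (b - c1)\<^sup>2" "\<epsilon> \<le> (b - c2)\<^sup>2" "b > 0" "c1 > 0" "c2 > 0"
  shows "is_disk c1 c2 (q1, q2, ln b) (\<lambda>\<zeta>. (disk \<epsilon> q1 c1 b \<zeta>, disk \<epsilon> q2 c2 b \<zeta>))"
  unfolding is_disk_def
proof (intro conjI)
  show "C1_on_disk (\<lambda>\<zeta>. (disk \<epsilon> q1 c1 b \<zeta>, disk \<epsilon> q2 c2 b \<zeta>))"
    by (rule C1_on_disk_pair[OF assms(1)])
  show "(\<lambda>\<zeta>. (disk \<epsilon> q1 c1 b \<zeta>, disk \<epsilon> q2 c2 b \<zeta>)) ` cball 0 1 \<subseteq> X' c1 c2"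
    using assms(1) by (auto simp: X'_def zmap_disk)
  show "(\<lambda>\<zeta>. (disk \<epsilon> q1 c1 b \<zeta>, disk \<epsilon> q2 c2 b \<zeta>)) ` sphere 0 1 \<subseteq> Lq c1 c2 (q1, q2, ln b)"
  proof (rule image_subsetI)
    fix \<zeta> :: complex assume "\<zeta> \<in> sphere 0 1"
    then have z: "cmod \<zeta> = 1" by simp
    show "(disk \<epsilon> q1 c1 b \<zeta>, disk \<epsilon> q2 c2 b \<zeta>) \<in> Lq c1 c2 (q1, q2, ln b)"
      using disk_moment_map[OF assms(1,2,4,5) z, of q1] disk_moment_map[OF assms(1,3,4,6) z, of q2]
        zmap_disk[OF assms(1), of c1 q1 b \<zeta>] zmap_disk[OF assms(1), of c2 q2 b \<zeta>] assms z
      by (auto simp: Lq_def X'_def case_prod_beta norm_mult)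
  qed
qed

text \<open>The integrand is brought to the form \<open>b\<^sup>2\<close> times a function of
  \<open>b * \<zeta>\<close> that does not otherwise involve \<open>b\<close>, ready for the
  substitution \<open>z = b * \<zeta>\<close>.\<close>

lemma energy_disk_pair:
  assumes "\<epsilon> > 0"
  shows "energy \<rho> c1 (\<lambda>\<zeta>. (disk \<epsilon> q1 c1 b \<zeta>, disk \<epsilon> q2 c2 b \<zeta>)) =
    1 / (2 * pi) * integral (cball 0 1) (\<lambda>\<zeta>. b\<^sup>2 * (dens \<epsilon> q1 ((cmod (disk_w c1 1 (b *\<^sub>R \<zeta>)))\<^sup>2)
       + dens \<epsilon> q2 ((cmod (disk_w c2 1 (b *\<^sub>R \<zeta>)))\<^sup>2) + \<rho> (b *\<^sub>R \<zeta>)))"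
proof -
  have w: "disk_w c b \<zeta> = disk_w c 1 (b *\<^sub>R \<zeta>)" for c \<zeta>
    by (simp add: disk_w_def scaleR_conv_of_real)
  have "((\<lambda>\<zeta>. complex_of_real b * \<zeta>) has_derivative (\<lambda>h. of_real b * h)) (at p)" for p
    by (auto intro!: derivative_eq_intros)
  then have z: "jac (\<lambda>\<zeta>. complex_of_real b * \<zeta>) p = b\<^sup>2" for p
    by (subst jac_eq) (auto simp: power2_eq_square)
  show ?thesis
    unfolding energy_def fst_conv snd_conv zmap_disk[OF assms] jac_disk_u[OF assms] jac_disk_v[OF assms] z w
    by (simp add: algebra_simps scaleR_conv_of_real)
qed

section \<open>Integrals over concentric disks\<close>

lemma integrable_on_compact_continuous:
  fixes f :: "'a::euclidean_space \<Rightarrow> 'b::euclidean_space"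
  assumes "compact S" "continuous_on S f"
  shows "f integrable_on S"
  using borel_integrable_compact[OF assms] unfolding set_integrable_def[symmetric]
  by (rule set_borel_integral_eq_integral(1))

text \<open>Substitution by a homothety of the real plane, with Jacobian \<open>b\<^sup>2\<close>.
  Affine substitution is available on boxes, so \<open>f\<close> is first extended by zero from the
  ball to a box.\<close>

lemma has_integral_scale_cball:
  fixes f :: "complex \<Rightarrow> real"
  assumes "b > 0" "continuous_on UNIV f"
  shows "((\<lambda>x. b\<^sup>2 * f (b *\<^sub>R x)) has_integral integral (cball 0 b) f) (cball 0 1)"
proof -
  obtain p q where pq: "cball (0::complex) b \<subseteq> cbox p q"
    using bounded_subset_cbox_symmetric[OF bounded_cball] by blast
  let ?f = "\<lambda>x. if x \<in> cball 0 b then f x else 0"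
  have "f integrable_on cball 0 b"
    by (intro integrable_on_compact_continuous continuous_on_subset[OF assms(2)]) auto
  then have "(?f has_integral integral (cball 0 b) f) (cbox p q)"
    unfolding has_integral_restrict[OF pq] by (rule integrable_integral)
  from has_integral_affinity'[OF this assms(1), of 0, unfolded add_0_right]
  have "((\<lambda>x. ?f (b *\<^sub>R x)) has_integral integral (cball 0 b) f / b\<^sup>2) (cbox (p /\<^sub>R b) (q /\<^sub>R b))"
    by (simp add: divide_inverse mult.commute)
  then have "((\<lambda>x. b\<^sup>2 * ?f (b *\<^sub>R x)) has_integral b\<^sup>2 * (integral (cball 0 b) f / b\<^sup>2)) (cbox (p /\<^sub>R b) (q /\<^sub>R b))"
    by (rule has_integral_mult_right)
  moreover have "(\<lambda>x. b\<^sup>2 * ?f (b *\<^sub>R x)) = (\<lambda>x. if x \<in> cball 0 1 then b\<^sup>2 * f (b *\<^sub>R x) else 0)"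
    using assms(1) by (auto simp: fun_eq_iff)
  ultimately have I: "((\<lambda>x. if x \<in> cball 0 1 then b\<^sup>2 * f (b *\<^sub>R x) else 0) has_integral
      integral (cball 0 b) f) (cbox (p /\<^sub>R b) (q /\<^sub>R b))"
    using assms(1) by simp
  have sub: "cball (0::complex) 1 \<subseteq> cbox (p /\<^sub>R b) (q /\<^sub>R b)"
  proof
    fix x :: complex assume "x \<in> cball 0 1"
    then have "b *\<^sub>R x \<in> cbox p q" using pq assms(1) by (auto simp: subset_iff)
    then show "x \<in> cbox (p /\<^sub>R b) (q /\<^sub>R b)"
      using assms(1) by (auto simp: mem_box field_simps)
  qed
  show ?thesis using I unfolding has_integral_restrict[OF sub] .
qed

text \<open>The annulus between the two disks contains a box of positive content, on which the
  continuous function \<open>f\<close> has a positive minimum.\<close>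

lemma integral_cball_strict_mono:
  fixes f :: "complex \<Rightarrow> real"
  assumes "continuous_on UNIV f" "\<And>x. f x > 0" "0 < b" "b < b'"
  shows "integral (cball 0 b) f < integral (cball 0 b') f"
proof -
  \<comment> \<open>A point halfway across the annulus; with \<open>r\<close> a quarter of the
    width, the ball around it stays away from both boundary circles.\<close>
  define p where "p = complex_of_real ((b + b') / 2)"
  define r where "r = (b' - b) / 4"
  have r: "r > 0" "cmod p = b + 2 * r" "b' = b + 4 * r" using assms unfolding p_def norm_of_real by (auto simp: r_def field_simps)
  obtain k l where kl: "cbox k l \<subseteq> ball p r" "\<forall>i\<in>Basis. k \<bullet> i < l \<bullet> i"
    using open_contains_cbox[of "ball p r" p] r(1) by (metis centre_in_ball open_ball)
  have ball: "b < cmod x \<and> cmod x < b'" if "x \<in> cbox k l" for x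
  proof -
    have "cmod (p - x) < r" using kl(1) that by (auto simp: dist_norm)
    then show ?thesis
      using r norm_triangle_ineq2[of p x] norm_triangle_ineq2[of x p] by (simp add: norm_minus_commute)
  qed
  have int: "f integrable_on S" if "compact S" for S
    by (rule integrable_on_compact_continuous[OF that continuous_on_subset[OF assms(1)]]) simp
  have ne: "cbox k l \<noteq> {}" using kl(2) by (auto simp: box_ne_empty less_imp_le)
  obtain x0 where x0: "\<forall>x\<in>cbox k l. f x0 \<le> f x"
    using continuous_attains_inf[OF compact_cbox ne continuous_on_subset[OF assms(1)]] by blast
  have "0 < f x0 * measure lborel (cbox k l)"
    using assms(2) kl(2) by (simp add: content_pos_lt)
  also have "\<dots> \<le> integral (cbox k l) f"
    using integral_component_lbound[OF int[OF compact_cbox], of k l "f x0" 1] x0 by simp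
  finally have "integral (cball 0 b) f < integral (cball 0 b) f + integral (cbox k l) f" by simp
  also have "\<dots> = integral (cball 0 b \<union> cbox k l) f"
  proof (rule integral_Un[symmetric])
    have "cball 0 b \<inter> cbox k l = {}" using ball by force
    then show "negligible (cball 0 b \<inter> cbox k l)" by simp
  qed (use int in auto)
  also have "\<dots> \<le> integral (cball 0 b') f"
    using ball assms by (intro integral_subset_le int) (auto simp: less_imp_le compact_Un)
  finally show ?thesis .
qed

section \<open>Maslov index and disk classes\<close>

lemma exp_curve_deriv:
  "((\<lambda>s. exp (a * complex_of_real s) * x) has_vector_derivative a * x) (at 0)"
proof -
  have "((\<lambda>s. exp (a * s)) has_field_derivative a) (at (complex_of_real 0))"
    by (auto intro!: derivative_eq_intros)
  from has_vector_derivative_real_field[OF this]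
  show ?thesis by (rule has_vector_derivative_mult_left)
qed

text \<open>The frame consists of the generator \<open>(\<i> u, -\<i> v)\<close> of the circle action and the tangent vector of the
  boundary curve; its determinant is \<open>\<i> d(u v)/d\<theta> = - b \<zeta>\<close>.\<close>

lemma maslov_disk:
  assumes "\<epsilon> > 0" "\<epsilon> \<le> (b - c)\<^sup>2" "b > 0" "c > 0"
  shows "has_maslov_index (Lfactor c q (ln b)) (disk \<epsilon> q c b) 2"
proof -
  let ?L = "Lfactor c q (ln b)"
  let ?d = "disk \<epsilon> q c b"
  let ?z = "circlepath 0 1"
  define e where "e t = (\<i> * fst (?d (?z t)), - \<i> * snd (?d (?z t)))" for t
  define e' where "e' t = (complex_of_real (disk_du \<epsilon> q c b (?z t) (\<i> * ?z t)), disk_dv \<epsilon> q c b (?z t) (\<i> * ?z t))" for t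
  have z1: "cmod (?z t) = 1" for t
    by (simp add: circlepath norm_mult norm_exp_eq_Re)
  have contz: "continuous_on S ?z" for S
    unfolding circlepath_def part_circlepath_def linepath_def by (intro continuous_intros)
  have nz: "disk_u \<epsilon> q c b x \<noteq> 0" for x
    using disk_u_pos[OF assms(1), of q c b x] by auto
  have det: "cdet (e t) (e' t) = - of_real b * ?z t" for t
    using nz[of "?z t"]
    by (simp add: cdet_def e_def e'_def disk_def disk_dv_def field_simps power2_eq_square)
  have te: "e t \<in> tangent_at ?L (?d (?z t))" for t
    unfolding tangent_at_def
  proof (intro CollectI exI conjI allI)
    \<comment> \<open>The orbit of the circle action: it preserves both moduli and the product of
      the coordinates, hence \<open>?L\<close>.\<close>
    let ?g = "\<lambda>s. (exp (\<i> * of_real s) * fst (?d (?z t)), exp (- (\<i> * of_real s)) * snd (?d (?z t)))"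
    show "?g s \<in> ?L" for s
    proof -
      have eq: "exp (\<i> * of_real s) * u * (exp (- (\<i> * of_real s)) * v) = u * v" for u v :: complex
        by (simp add: exp_minus)
      show ?thesis
        using disk_in_Lfactor[OF assms z1[of t], of q] unfolding Lfactor_def
        by (simp add: case_prod_beta zmap_def eq) (simp add: norm_mult)
    qed
    show "?g 0 = ?d (?z t)" by simp
    show "(?g has_vector_derivative e t) (at 0)"
      unfolding e_def
      by (intro has_vector_derivative_Pair) (use exp_curve_deriv[of "\<i>"] exp_curve_deriv[of "- \<i>"] in auto)
  qed
  have te': "e' t \<in> tangent_at ?L (?d (?z t))" for t
    unfolding tangent_at_def
  proof (intro CollectI exI conjI allI)
    \<comment> \<open>The boundary of the disk, traversed by rotating
      \<open>\<zeta>\<close>.\<close>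
    let ?g = "\<lambda>s::real. ?d (exp (\<i> * of_real s) * ?z t)"
    show "?g s \<in> ?L" for s
      using disk_in_Lfactor[OF assms, of "exp (\<i> * of_real s) * ?z t" q] by (simp add: norm_mult z1)
    show "?g 0 = ?d (?z t)" by simp
    have *: "((\<lambda>s. exp (\<i> * complex_of_real s) * ?z t) has_vector_derivative \<i> * ?z t) (at 0)"
      by (rule exp_curve_deriv)
    have "(?d has_derivative (\<lambda>h. (of_real (disk_du \<epsilon> q c b (?z t) h), disk_dv \<epsilon> q c b (?z t) h)))
        (at (exp (\<i> * complex_of_real 0) * ?z t) within ((\<lambda>s. exp (\<i> * complex_of_real s) * ?z t) ` UNIV))"
      using has_derivative_at_withinI[OF disk_deriv[OF assms(1)]] by simp
    from vector_derivative_diff_chain_within[OF * this]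
    show "(?g has_vector_derivative e' t) (at 0)"
      by (simp add: o_def e'_def)
  qed
  \<comment> \<open>The normalised square of \<open>- b * \<zeta>\<close> is
    \<open>\<zeta>\<^sup>2\<close>, which turns twice around 0 as \<open>\<zeta>\<close> turns
    once.\<close>
  have "(\<lambda>t. (cdet (e t) (e' t))\<^sup>2 / of_real ((cmod (cdet (e t) (e' t)))\<^sup>2)) = exp \<circ> linepath 0 (4 * pi * \<i>)"
  proof
    fix t
    have "(?z t)\<^sup>2 = exp (linepath 0 (4 * pi * \<i>) t)"
      by (simp add: circlepath exp_double[symmetric] linepath_def scaleR_conv_of_real mult_ac)
    then show "(cdet (e t) (e' t))\<^sup>2 / of_real ((cmod (cdet (e t) (e' t)))\<^sup>2) = (exp \<circ> linepath 0 (4 * pi * \<i>)) t"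
      using assms(3) by (simp add: det norm_mult z1 power_mult_distrib)
  qed
  then have "winding_number (\<lambda>t. (cdet (e t) (e' t))\<^sup>2 / of_real ((cmod (cdet (e t) (e' t)))\<^sup>2)) 0 = of_int 2"
    by (simp add: winding_number_compose_exp)
  moreover have "continuous_on {0..1} e" "continuous_on {0..1} e'"
    unfolding e_def e'_def disk_def fst_conv snd_conv using nz
    by (intro continuous_intros contz assms; simp)+
  moreover have "cdet (e t) (e' t) \<noteq> 0" for t
    using z1[of t] assms(3) by (auto simp: det)
  ultimately show ?thesis
    unfolding has_maslov_index_def using te te' by blast
qed

text \<open>For \<open>b < c\<close> the closed disk of radius \<open>b\<close> about
  \<open>c\<close> misses 0, and the product of the components runs through that disk.\<close>

lemma represents_hat_disk:
  assumes "\<epsilon> > 0" "\<epsilon> \<le> (b - c)\<^sup>2" "b > 0" "b < c"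
  shows "represents_hat c q (ln b) (disk \<epsilon> q c b)"
  unfolding represents_hat_def
proof (intro conjI ballI)
  show "has_maslov_index (Lfactor c q (ln b)) (disk \<epsilon> q c b) 2"
    using assms by (intro maslov_disk) auto
  fix \<zeta> :: complex assume "\<zeta> \<in> cball 0 1"
  then have "b * cmod \<zeta> \<le> b" using assms(3) by (simp add: mult_left_le)
  then have "b * cmod \<zeta> < c" using assms(4) by linarith
  then have "cmod (of_real b * \<zeta>) < cmod (of_real c)"
    using assms(3,4) by (simp add: norm_mult)
  then have "disk_w c b \<zeta> \<noteq> 0"
    by (metis disk_w_def add_eq_0_iff norm_minus_cancel less_irrefl)
  then show "fst (disk \<epsilon> q c b \<zeta>) * snd (disk \<epsilon> q c b \<zeta>) \<noteq> 0"
    by (simp add: disk_prod[OF assms(1)])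
qed

text \<open>For \<open>b > c\<close> the circle of radius \<open>b\<close> about \<open>c\<close>
  winds once around 0. On it \<open>v\<close> is \<open>w\<close> divided by a positive function, so
  both loops have the same winding number.\<close>

lemma represents_plus_disk:
  assumes "\<epsilon> > 0" "\<epsilon> \<le> (b - c)\<^sup>2" "c > 0" "c < b"
  shows "represents_plus c q (ln b) (disk \<epsilon> q c b)"
  unfolding represents_plus_def
proof (intro conjI)
  show "has_maslov_index (Lfactor c q (ln b)) (disk \<epsilon> q c b) 2"
    using assms by (intro maslov_disk) auto
  let ?v = "(\<lambda>\<zeta>. snd (disk \<epsilon> q c b \<zeta>)) \<circ> circlepath 0 1"
  have z1: "cmod (circlepath 0 1 t) = 1" for t
    by (simp add: circlepath norm_mult norm_exp_eq_Re)
  have nz: "disk_u \<epsilon> q c b x > 0" for x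
    by (rule disk_u_pos[OF assms(1)])
  have w: "circlepath (of_real c) b t = disk_w c b (circlepath 0 1 t)" for t
    by (simp add: disk_w_def circlepath)
  have "winding_number ?v 0 = winding_number (circlepath (of_real c) b) 0"
  proof (rule winding_number_loops_linear_eq)
    have "continuous_on UNIV (\<lambda>\<zeta>. snd (disk \<epsilon> q c b \<zeta>))"
    proof -
      have "complex_of_real (disk_u \<epsilon> q c b x) \<noteq> 0" for x using nz[of x] by simp
      then show ?thesis unfolding disk_def snd_conv by (intro continuous_intros assms) simp
    qed
    then show "path ?v"
      by (intro path_continuous_image path_circlepath) (rule continuous_on_subset[OF _ subset_UNIV])
    show "pathfinish ?v = pathstart ?v"
      by (simp add: pathfinish_compose pathstart_compose)
    fix t :: real
    let ?z = "circlepath 0 1 t"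
    have "disk_w c b ?z \<noteq> 0"
    proof
      assume "disk_w c b ?z = 0"
      then have "cmod (of_real b * ?z) = cmod (of_real c)"
        by (metis disk_w_def add_eq_0_iff norm_minus_cancel)
      then show False using assms by (simp add: norm_mult z1)
    qed
    moreover have "disk_w c b ?z = of_real (disk_u \<epsilon> q c b ?z) * ?v t"
      using nz[of ?z] by (simp add: disk_def)
    ultimately have v: "circlepath (of_real c) b t = of_real (disk_u \<epsilon> q c b ?z) * ?v t" "?v t \<noteq> 0"
      unfolding w by auto
    \<comment> \<open>The endpoints are positive real multiples of one nonzero number, so the
      straight homotopy avoids 0.\<close>
    show "0 \<notin> closed_segment (circlepath (of_real c) b t) (?v t)"
    proof
      assume "0 \<in> closed_segment (circlepath (of_real c) b t) (?v t)"
      then obtain s where s: "0 \<le> s" "s \<le> 1" "(1 - s) *\<^sub>R circlepath (of_real c) b t + s *\<^sub>R ?v t = 0"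
        unfolding in_segment(1) by metis
      then have "of_real ((1 - s) * disk_u \<epsilon> q c b ?z + s) * ?v t = 0"
        unfolding v(1) by (simp add: scaleR_conv_of_real algebra_simps)
      then have "(1 - s) * disk_u \<epsilon> q c b ?z + s = 0" using v(2) by (metis mult_eq_0_iff of_real_eq_0_iff)
      moreover have "(1 - s) * disk_u \<epsilon> q c b ?z \<ge> 0" using s nz[of ?z] by simp
      ultimately have "s = 0" "(1 - s) * disk_u \<epsilon> q c b ?z = 0" using s by linarith+
      then show False using nz[of ?z] by simp
    qed
  qed simp_all
  also have "\<dots> = 1"
    using assms by (intro winding_number_circlepath) (simp add: norm_minus_commute)
  finally show "winding_number ?v 0 = 1" .
qed

section \<open>Monotonicity of \<open>\<psi>\<close>\<close>

text \<open>With one \<open>\<epsilon>\<close> for both radii, the two energies integrate the same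
  positive density \<open>f\<close> over nested disks in the \<open>z\<close>-plane.\<close>

lemma energy_disk_pair_less:
  assumes "\<epsilon> > 0" "continuous_on UNIV \<rho>" "\<And>z. \<rho> z \<ge> 0" "0 < b" "b < b'"
  shows "energy \<rho> c1 (\<lambda>\<zeta>. (disk \<epsilon> q1 c1 b \<zeta>, disk \<epsilon> q2 c2 b \<zeta>))
    < energy \<rho> c1 (\<lambda>\<zeta>. (disk \<epsilon> q1 c1 b' \<zeta>, disk \<epsilon> q2 c2 b' \<zeta>))"
proof -
  define f where "f z = dens \<epsilon> q1 ((cmod (disk_w c1 1 z))\<^sup>2) + dens \<epsilon> q2 ((cmod (disk_w c2 1 z))\<^sup>2) + \<rho> z" for z
  have cont: "continuous_on UNIV f"
    unfolding f_def by (intro continuous_intros assms) auto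
  have pos: "f z > 0" for z
    unfolding f_def using dens_pos[OF assms(1)] assms(3) by (intro add_pos_nonneg add_pos_pos) auto
  have "energy \<rho> c1 (\<lambda>\<zeta>. (disk \<epsilon> q1 c1 b \<zeta>, disk \<epsilon> q2 c2 b \<zeta>)) = 1 / (2 * pi) * integral (cball 0 b) f" if "b > 0" for b
    unfolding energy_disk_pair[OF assms(1)]
    using integral_unique[OF has_integral_scale_cball[OF that cont]] by (simp add: f_def)
  moreover have "integral (cball 0 b) f < integral (cball 0 b') f"
    by (rule integral_cball_strict_mono[OF cont pos assms(4,5)])
  ultimately show ?thesis using assms(4,5) by (simp add: divide_strict_right_mono)
qed

text \<open>Passing to the limit at an endpoint yields only weak inequalities; two intermediate
  points \<open>u < v\<close> supply the strict one.\<close>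

lemma strict_mono_on_closure_interval:
  fixes f :: "real \<Rightarrow> real"
  assumes cont: "continuous_on UNIV f" and mono: "\<And>x y. a < x \<Longrightarrow> x < y \<Longrightarrow> y < b \<Longrightarrow> f x < f y"
    and xy: "a \<le> x" "x < y" "y \<le> b"
  shows "f x < f y"
proof -
  have c: "isCont f z" for z using cont by (simp add: continuous_on_eq_continuous_at)
  define u v where "u = (2 * x + y) / 3" and "v = (x + 2 * y) / 3"
  have uv: "x < u" "u < v" "v < y" using xy by (auto simp: u_def v_def)
  have "f x \<le> f u"
  proof (rule tendsto_upperbound)
    show "(f \<longlongrightarrow> f x) (at_right x)" using c[of x] by (simp add: isCont_def filterlim_at_split)
    have "\<forall>\<^sub>F t in at_right x. t < u" using uv(1) eventually_at_right_real
      by (auto simp: eventually_at_right)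
    moreover have "\<forall>\<^sub>F t in at_right x. x < t" by (simp add: eventually_at_right_less)
    ultimately show "\<forall>\<^sub>F t in at_right x. f t \<le> f u"
      by eventually_elim (use mono uv xy in \<open>force intro: less_imp_le\<close>)
  qed simp
  moreover have "f v \<le> f y"
  proof (rule tendsto_lowerbound)
    show "(f \<longlongrightarrow> f y) (at_left y)" using c[of y] by (simp add: isCont_def filterlim_at_split)
    have "\<forall>\<^sub>F t in at_left y. v < t" using uv(3)
      by (auto simp: eventually_at_left)
    moreover have "\<forall>\<^sub>F t in at_left y. t < y" by (simp add: eventually_at_filter)
    ultimately show "\<forall>\<^sub>F t in at_left y. f v \<le> f t"
      by eventually_elim (use mono uv xy in \<open>force intro: less_imp_le\<close>)
  qed simp
  moreover have "f u < f v" using mono uv xy by auto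
  ultimately show ?thesis by linarith
qed

text \<open>Within a chamber \<open>\<psi>\<close> is the energy of the explicit disks up to a
  constant. Continuity extends the inequality to the closed chambers, and the values at the two
  walls link these.\<close>

lemma is_psi_strict_mono:
  assumes "is_psi \<rho> c1 c2 \<psi>" "continuous_on UNIV \<rho>" "\<And>z. \<rho> z \<ge> 0" "0 < c2" "c2 < c1"
  shows "strict_mono (\<lambda>s. \<psi> (q1, q2, s))"
proof -
  let ?f = "\<lambda>s. \<psi> (q1, q2, s)"
  let ?s1 = "ln c1" and ?s2 = "ln c2"
  let ?g = "\<lambda>\<epsilon> b \<zeta>. (disk \<epsilon> q1 c1 b \<zeta>, disk \<epsilon> q2 c2 b \<zeta>)"
  have cont: "continuous_on UNIV ?f"
  proof (rule continuous_on_compose2[of UNIV \<psi>])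
    show "continuous_on UNIV \<psi>" using assms(1) unfolding is_psi_def by (rule conjunct1)
    show "continuous_on UNIV (\<lambda>s. (q1, q2, s))" by (intro continuous_intros)
  qed simp
  have c: "?s2 < ?s1" using assms by simp
  have key: "?f s < ?f t" if st: "s < t" and region: "t < ?s2 \<or> ?s2 < s \<and> t < ?s1 \<or> ?s1 < s" for s t
  proof -
    \<comment> \<open>Small enough for the boundary conditions of both factors at both radii, so a
      single profile serves \<open>s\<close> and \<open>t\<close>. It is positive because neither
      lies on a wall.\<close>
    define \<epsilon> where "\<epsilon> = min (min ((exp s - c1)\<^sup>2) ((exp s - c2)\<^sup>2)) (min ((exp t - c1)\<^sup>2) ((exp t - c2)\<^sup>2))"
    have "s \<noteq> ?s1" "s \<noteq> ?s2" "t \<noteq> ?s1" "t \<noteq> ?s2"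
      using st region c by linarith+
    then have "exp s \<noteq> c1" "exp s \<noteq> c2" "exp t \<noteq> c1" "exp t \<noteq> c2"
      by (metis ln_exp)+
    then have e: "\<epsilon> > 0" by (simp add: \<epsilon>_def)
    \<comment> \<open>The correction to the energy in the chamber containing \<open>s\<close> and
      \<open>t\<close>; it cancels in the comparison.\<close>
    define k where "k = (if t < ?s2 then 0 else if t < ?s1 then min 0 q2 else min 0 q1 + min 0 q2)"
    have psi: "?f r = energy \<rho> c1 (?g \<epsilon> (exp r)) + k" if r: "r \<in> {s, t}" for r
    proof -
      have ee: "\<epsilon> \<le> (exp r - c1)\<^sup>2" "\<epsilon> \<le> (exp r - c2)\<^sup>2" using r by (auto simp: \<epsilon>_def)
      have d: "is_disk c1 c2 (q1, q2, r) (?g \<epsilon> (exp r))"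
        using is_disk_pair[OF e ee, of q1 q2] assms by simp
      have p1: "fst \<circ> ?g \<epsilon> (exp r) = disk \<epsilon> q1 c1 (exp r)" and p2: "snd \<circ> ?g \<epsilon> (exp r) = disk \<epsilon> q2 c2 (exp r)"
        by (auto simp: fun_eq_iff)
      have hat: "represents_hat c q r (disk \<epsilon> q c (exp r))" if "r < ln c" "\<epsilon> \<le> (exp r - c)\<^sup>2" "c > 0" for c q
      proof -
        have "exp r < c" using that by (metis exp_less_cancel_iff exp_ln)
        then show ?thesis using represents_hat_disk[OF e that(2), of q] by simp
      qed
      have plus: "represents_plus c q r (disk \<epsilon> q c (exp r))" if "ln c < r" "\<epsilon> \<le> (exp r - c)\<^sup>2" "c > 0" for c q
      proof -
        have "c < exp r" using that by (metis exp_less_cancel_iff exp_ln)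
        then show ?thesis using represents_plus_disk[OF e that(2,3), of q] by simp
      qed
      note P = assms(1)[unfolded is_psi_def, THEN conjunct2, rule_format, OF d, unfolded p1 p2]
      consider "t < ?s2" | "?s2 < s" "t < ?s1" | "?s1 < s" using region by (elim disjE conjE)
      then show ?thesis
      proof cases
        case 1
        then have "r < ?s2" "k = 0" using r st by (auto simp: k_def)
        then show ?thesis using P hat[of c1 q1] hat[of c2 q2] ee assms(4,5) c by simp
      next
        case 2
        then have "\<not> t < ?s2" using st by linarith
        then have "k = min 0 q2" using 2 by (simp only: k_def if_False if_True)
        moreover have "?s2 < r" "r < ?s1" using 2 r st by auto
        ultimately show ?thesis using P hat[of c1 q1] plus[of c2 q2] ee assms(4,5) by simp
      next
        case 3
        then have "\<not> t < ?s2" "\<not> t < ?s1" using st c by linarith+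
        then have "k = min 0 q1 + min 0 q2" by (simp only: k_def if_False)
        moreover have "?s1 < r" "?s2 < r" using 3 r st c by auto
        ultimately show ?thesis using P plus[of c1 q1] plus[of c2 q2] ee assms(4,5) by simp
      qed
    qed
    show ?thesis
      using energy_disk_pair_less[OF e assms(2,3), of "exp s" "exp t" c1 q1 q2 c2] psi[of s] psi[of t] st
      by simp
  qed
  \<comment> \<open>The outer chambers are unbounded; \<open>s - 1\<close> and \<open>t + 1\<close>
    merely cut out finite intervals around the two points.\<close>
  have m1: "?f s < ?f t" if "s < t" "t \<le> ?s2" for s t
    by (rule strict_mono_on_closure_interval[OF cont key, of "s - 1" ?s2]) (use that in auto)
  have m2: "?f s < ?f t" if "s < t" "?s2 \<le> s" "t \<le> ?s1" for s t
    by (rule strict_mono_on_closure_interval[OF cont key, of ?s2 ?s1]) (use that in auto)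
  have m3: "?f s < ?f t" if "s < t" "?s1 \<le> s" for s t
    by (rule strict_mono_on_closure_interval[OF cont key, of ?s1 "t + 1"]) (use that in auto)
  show ?thesis
  proof (rule strict_monoI)
    fix s t :: real assume st: "s < t"
    have m23: "?f s < ?f t" if st: "s < t" "?s2 \<le> s" for s t
    proof (cases "s < ?s1 \<and> ?s1 < t")
      case True
      then show ?thesis using m2[of s ?s1] m3[of ?s1 t] st(2) by linarith
    next
      case False
      then show ?thesis using m2[OF st] m3[OF st(1)] by linarith
    qed
    show "?f s < ?f t"
    proof (cases "s < ?s2 \<and> ?s2 < t")
      case True
      then show ?thesis using m1[of s ?s2] m23[of ?s2 t] by linarith
    next
      case False
      then show ?thesis using m1[OF st] m23[OF st] by linarith
    qed
  qed
qed

section \<open>Injectivity of \<open>j\<close>\<close>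

lemma median_determines:
  fixes x y a b :: real
  assumes "min (- x) (- a) = min (- y) (- a)" "min x b = min y b" "median x a b = median y a b"
  shows "x = y"
proof (rule ccontr)
  assume "x \<noteq> y"
  \<comment> \<open>A truncation that identifies two distinct numbers must truncate both. Both then
    lie between \<open>b\<close> and \<open>a\<close>, where the median is the identity.\<close>
  then have "x \<le> a" "y \<le> a" "b \<le> x" "b \<le> y"  using assms(1,2)
    by (simp_all add: min_def split: if_splits)
  then show False using assms(3) \<open>x \<noteq> y\<close> by (simp add: median_def min_def max_def split: if_splits)
qed

text \<open>The last two components are \<open>q1\<close> and \<open>q2\<close>, the first three
  determine the value of \<open>\<psi>\<close>, and strict monotonicity recovers \<open>q3\<close>.
  This makes \<open>inv\<close> a genuine left inverse in \<open>fmap\<close>.\<close>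

lemma jmap_inj:
  assumes "is_psi \<rho> c1 c2 \<psi>" "continuous_on UNIV \<rho>" "\<And>z. \<rho> z \<ge> 0" "0 < c2" "c2 < c1"
  shows "inj (jmap \<psi> c1 c2)"
proof (rule injI)
  fix p p' assume eq: "jmap \<psi> c1 c2 p = jmap \<psi> c1 c2 p'"
  obtain q1 q2 s where p: "p = (q1, q2, s)" by (cases p)
  obtain q1' q2' t where p': "p' = (q1', q2', t)" by (cases p')
  have q: "q1' = q1" "q2' = q2" using eq by (auto simp: p p' jmap_def)
  have "\<psi> (q1, q2, s) = \<psi> (q1, q2, t)"
    by (rule median_determines[of _ "psi_at \<psi> c1 q1 q2" _ "psi_at \<psi> c2 q1 q2"])
      (use eq in \<open>simp_all add: p p' q jmap_def\<close>)
  then have "s = t"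
    using is_psi_strict_mono[OF assms, THEN strict_mono_eq] by auto
  then show "p = p'" by (simp add: p p' q)
qed

section \<open>The images of \<open>C1\<close> and \<open>C2\<close>\<close>

text \<open>The homogeneous coordinates are defined up to scaling, so for \<open>Z0\<close> and
  \<open>Z1\<close> only vanishing is asserted.\<close>

lemma Y_classical_point:
  fixes a :: "coord \<Rightarrow> novikov"
  assumes "a Z0 \<noteq> 0 \<or> a Z1 \<noteq> 0" "a Y1 \<noteq> 0" "a Y2 \<noteq> 0"
    "a X1 * a Z0 = (1 + a Y1) * a Z1" "a X2 * a Z1 = (1 + a Y2) * a Z0"
  obtains P where "P \<in> Y_classical"
    "\<And>k. k \<notin> {Z0, Z1} \<Longrightarrow> absval P (Var k) = nabs (a k)"
    "\<And>k. k \<notin> {Z0, Z1} \<Longrightarrow> absval P (Var k + 1) = nabs (a k + 1)"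
    "\<And>k. absval P (Var k) = 0 \<longleftrightarrow> a k = 0"
proof -
  let ?\<mu> = "\<lambda>p. nabs (peval a p)"
  have \<mu>: "?\<mu> \<in> Y_seminorms" by (rule peval_in_Y_seminorms[OF assms])
  let ?P = "scaling_rel `` {?\<mu>}"
  obtain t where t: "t > 0"
    "\<And>d p. Z_homogeneous d p \<Longrightarrow> absval ?P p = t ^ d * ?\<mu> p"
    using absval_class[OF \<mu>] by blast
  have "?P \<in> Y_an" unfolding Y_an_def using \<mu> by (rule quotientI)
  moreover have "?\<mu> \<in> ?P" using scaling_rel_refl[OF \<mu>] by auto
  ultimately have "?P \<in> Y_classical" unfolding Y_classical_def by blast
  moreover have "absval ?P (Var k) = nabs (a k)" if "k \<notin> {Z0, Z1}" for k
    using t(2)[OF Z_homogeneous_Var[of k]] that by simp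
  moreover have "absval ?P (Var k + 1) = nabs (a k + 1)" if "k \<notin> {Z0, Z1}" for k
    using t(2)[OF Z_homogeneous_Var_plus_1[of k]] that by (simp add: peval_add)
  moreover have "absval ?P (Var k) = 0 \<longleftrightarrow> a k = 0" for k
    using t(2)[OF Z_homogeneous_Var[of k]] t(1) by simp
  ultimately show ?thesis by (rule that)
qed

lemma Fmap_C1:
  assumes "P \<in> C1" and "\<And>q1 q2. psi_at \<psi> c2 q1 q2 < psi_at \<psi> c1 q1 q2"
  shows "Fmap \<psi> c1 c2 P = jmap \<psi> c1 c2 (0, - ln (absval P (Var Y2)), ln c1)"
proof -
  let ?a = "- ln (absval P (Var Y2))"
  have P: "P \<in> Y_an" "absval P (Var X1) = 0" "absval P (Var X2) = 0"
    "absval P (Var Y1 + 1) = 0" "absval P (Var Z0) = 0"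
    using assms(1) by (auto simp: C1_def)
  \<comment> \<open>Since \<open>Z0\<close> vanishes, \<open>Z1\<close> does not; thus
    \<open>v_z P\<close> is infinity minus a finite number, and the median becomes the larger of the
    two values of \<open>\<psi>\<close>.\<close>
  have "absval P (Var Z1) \<noteq> 0" "absval P (Var Y2) \<noteq> 0"
    using absval_in_Y_seminorms[OF P(1)] P(5) by (auto simp: Y_seminorms_def)
  then have "v_of X1 P = \<infinity>" "v_of X2 P = \<infinity>" "v_of Y1 P = ereal 0" "v_of Y2 P = ereal ?a" "v_z P = \<infinity>"
    using P absval_Var_eq_1[OF P(1,4)] by (simp_all add: v_of_def neg_ln_def v_z_def)
  then show ?thesis
    using assms(2)[of 0 ?a]
    by (simp add: Fmap_def jmap_def Let_def median_def psi_at_def min_def max_def)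
qed

text \<open>At \<open>z = \<infinity>\<close> the valuation of \<open>z\<close> is minus infinity,
  so the median is the smaller value \<open>psi_at \<psi> c2\<close>, as it is for \<open>j\<close>
  at \<open>q3 = ln c2\<close>.\<close>

lemma Fmap_C2:
  assumes "P \<in> C2" and "\<And>q1 q2. psi_at \<psi> c2 q1 q2 < psi_at \<psi> c1 q1 q2"
  shows "Fmap \<psi> c1 c2 P = jmap \<psi> c1 c2 (- ln (absval P (Var Y1)), 0, ln c2)"
proof -
  let ?a = "- ln (absval P (Var Y1))"
  have P: "P \<in> Y_an" "absval P (Var X1) = 0" "absval P (Var X2) = 0"
    "absval P (Var Y2 + 1) = 0" "absval P (Var Z1) = 0"
    using assms(1) by (auto simp: C2_def)
  have "absval P (Var Z0) \<noteq> 0" "absval P (Var Y1) \<noteq> 0"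
    using absval_in_Y_seminorms[OF P(1)] P(5) by (auto simp: Y_seminorms_def)
  then have "v_of X1 P = \<infinity>" "v_of X2 P = \<infinity>" "v_of Y2 P = ereal 0" "v_of Y1 P = ereal ?a" "v_z P = - \<infinity>"
    using P absval_Var_eq_1[OF P(1,4)] by (simp_all add: v_of_def neg_ln_def v_z_def)
  then show ?thesis
    using assms(2)[of ?a 0]
    by (simp add: Fmap_def jmap_def Let_def median_def psi_at_def min_def max_def)
qed

lemma C1_classical_surj:
  obtains P where "P \<in> C1" "P \<in> Y_classical" "- ln (absval P (Var Y2)) = q"
proof -
  \<comment> \<open>The point \<open>z = [0 : 1]\<close>, \<open>y1 = - 1\<close>, with
    \<open>y2\<close> a monomial of valuation \<open>q\<close>; both equations read
    \<open>0 = 0\<close>.\<close>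
  define a where "a k = (case k of Z1 \<Rightarrow> 1 | Y1 \<Rightarrow> - 1 | Y2 \<Rightarrow> nmonom q | _ \<Rightarrow> 0)" for k
  have "nmonom q \<noteq> 0" using nabs_nmonom[of q] by auto
  then obtain P where P: "P \<in> Y_classical"
    "\<And>k. k \<notin> {Z0, Z1} \<Longrightarrow> absval P (Var k) = nabs (a k)"
    "\<And>k. k \<notin> {Z0, Z1} \<Longrightarrow> absval P (Var k + 1) = nabs (a k + 1)"
    "\<And>k. absval P (Var k) = 0 \<longleftrightarrow> a k = 0"
    using Y_classical_point[of a] unfolding a_def by auto
  then have "P \<in> C1" by (simp add: C1_def Y_classical_def a_def)
  moreover have "- ln (absval P (Var Y2)) = q" using P(2)[of Y2] by (simp add: a_def nabs_nmonom)
  ultimately show ?thesis using that P(1) by blast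
qed

lemma C2_classical_surj:
  obtains P where "P \<in> C2" "P \<in> Y_classical" "- ln (absval P (Var Y1)) = q"
proof -
  \<comment> \<open>The mirror image at \<open>z = [1 : 0]\<close>, with the roles of
    \<open>y1\<close> and \<open>y2\<close> exchanged.\<close>
  define a where "a k = (case k of Z0 \<Rightarrow> 1 | Y2 \<Rightarrow> - 1 | Y1 \<Rightarrow> nmonom q | _ \<Rightarrow> 0)" for k
  have "nmonom q \<noteq> 0" using nabs_nmonom[of q] by auto
  then obtain P where P: "P \<in> Y_classical"
    "\<And>k. k \<notin> {Z0, Z1} \<Longrightarrow> absval P (Var k) = nabs (a k)"
    "\<And>k. k \<notin> {Z0, Z1} \<Longrightarrow> absval P (Var k + 1) = nabs (a k + 1)"
    "\<And>k. absval P (Var k) = 0 \<longleftrightarrow> a k = 0"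
    using Y_classical_point[of a] unfolding a_def by auto
  then have "P \<in> C2" by (simp add: C2_def Y_classical_def a_def)
  moreover have "- ln (absval P (Var Y1)) = q" using P(2)[of Y1] by (simp add: a_def nabs_nmonom)
  ultimately show ?thesis using that P(1) by blast
qed

theorem mainTheorem2:
  fixes c1 c2 :: real and \<rho> :: "complex \<Rightarrow> real" and \<psi> :: "real \<times> real \<times> real \<Rightarrow> real"
    and S :: "point set"
  assumes "c1 > c2" and "c2 > 0"
    and "continuous_on UNIV \<rho>" and "\<And>z. \<rho> z \<ge> 0"
    and "is_psi \<rho> c1 c2 \<psi>"
    and "S = Y_an \<or> S = Y_classical"
  shows "C1 \<subseteq> scrY \<and> C2 \<subseteq> scrY \<and>
    jmap \<psi> c1 c2 ` Delta1 c1 = Fmap \<psi> c1 c2 ` (C1 \<inter> S) \<and>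
    jmap \<psi> c1 c2 ` Delta2 c2 = Fmap \<psi> c1 c2 ` (C2 \<inter> S) \<and>
    fmap \<psi> c1 c2 ` (C1 \<inter> S) = Delta1 c1 \<and>
    fmap \<psi> c1 c2 ` (C2 \<inter> S) = Delta2 c2"
proof -
  have less: "psi_at \<psi> c2 q1 q2 < psi_at \<psi> c1 q1 q2" for q1 q2
    unfolding psi_at_def
    using strict_monoD[OF is_psi_strict_mono[OF assms(5,3,4,2,1), of q1 q2], of "ln c2" "ln c1"] assms(1,2)
    by simp
  \<comment> \<open>Both choices of \<open>S\<close> are treated at once: preimages are found among
    classical points, while \<open>Fmap_C1\<close> and \<open>Fmap_C2\<close> hold at every
    Berkovich point of \<open>C1\<close> and \<open>C2\<close>.\<close>
  have S: "Y_classical \<subseteq> S" "S \<subseteq> Y_an" using assms(6) by (auto simp: Y_classical_def)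
  have sub: "C1 \<subseteq> scrY" "C2 \<subseteq> scrY" by (auto simp: C1_def C2_def scrY_def)
  have j1: "jmap \<psi> c1 c2 ` Delta1 c1 = Fmap \<psi> c1 c2 ` (C1 \<inter> S)"
  proof (intro equalityI image_subsetI)
    fix p assume "p \<in> Delta1 c1"
    then obtain q where p: "p = (0, q, ln c1)" by (auto simp: Delta1_def)
    obtain P where "P \<in> C1" "P \<in> Y_classical" "- ln (absval P (Var Y2)) = q"
      by (rule C1_classical_surj)
    then show "jmap \<psi> c1 c2 p \<in> Fmap \<psi> c1 c2 ` (C1 \<inter> S)"
      using Fmap_C1[OF _ less, of P] S(1) p by (intro image_eqI[of _ _ P]) auto
  next
    fix P assume "P \<in> C1 \<inter> S"
    then show "Fmap \<psi> c1 c2 P \<in> jmap \<psi> c1 c2 ` Delta1 c1"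
      using Fmap_C1[OF _ less, of P] by (auto simp: Delta1_def)
  qed
  have j2: "jmap \<psi> c1 c2 ` Delta2 c2 = Fmap \<psi> c1 c2 ` (C2 \<inter> S)"
  proof (intro equalityI image_subsetI)
    fix p assume "p \<in> Delta2 c2"
    then obtain q where p: "p = (q, 0, ln c2)" by (auto simp: Delta2_def)
    obtain P where "P \<in> C2" "P \<in> Y_classical" "- ln (absval P (Var Y1)) = q"
      by (rule C2_classical_surj)
    then show "jmap \<psi> c1 c2 p \<in> Fmap \<psi> c1 c2 ` (C2 \<inter> S)"
      using Fmap_C2[OF _ less, of P] S(1) p by (intro image_eqI[of _ _ P]) auto
  next
    fix P assume "P \<in> C2 \<inter> S"
    then show "Fmap \<psi> c1 c2 P \<in> jmap \<psi> c1 c2 ` Delta2 c2"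
      using Fmap_C2[OF _ less, of P] by (auto simp: Delta2_def)
  qed
  have f: "fmap \<psi> c1 c2 ` A = D" if "A \<subseteq> scrY" "jmap \<psi> c1 c2 ` D = Fmap \<psi> c1 c2 ` A" for A D
  proof -
    have "fmap \<psi> c1 c2 ` A = inv (jmap \<psi> c1 c2) ` Fmap \<psi> c1 c2 ` A"
      unfolding image_image using that(1) by (intro image_cong) (auto simp: fmap_def)
    then show ?thesis
      using image_inv_f_f[OF jmap_inj[OF assms(5,3,4,2,1)], of D] that(2) by simp
  qed
  show ?thesis using sub j1 j2 f[OF _ j1] f[OF _ j2] by blast
qed

end
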